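(* Let $\mathcal{C}$ be an arbitrary set of corner-interval minors of $M$ and let $H_1,\ldots,H_r$ be the maximal horizontal intervals of $\mathcal{C}$. If $\mathcal{C}'$ is the set of corner-interval minors obtained by removing $H_k$ from $\mathcal{C}$, for some $k$, then $$\beta_{ij}(S/I(\mathcal{C}')^t)\le\beta_{ij}(S/I(\mathcal{C})^t)$$ for all $i,j\ge0$ and $t\ge1$.
   Context: Let $K$ be a field and $M=(x_{ij})$ an $m\times n$ matrix of indeterminates. A 2-minor is $\delta=[a_1,a_2|b_1,b_2]$ with $a_1<a_2$, $b_1<b_2$; its vertex set is $V(\delta)=\{x_{a_1b_1},x_{a_1b_2},x_{a_2b_1},x_{a_2b_2}\}$, and its horizontal edges are $\{x_{a_1b_1},x_{a_1b_2}\}$ and $\{x_{a_2b_1},x_{a_2b_2}\}$. It is a corner-interval minor if $b_1=1$. For a set $\mathcal{C}$ of 2-minors, $V(\mathcal{C})$ is the union of the vertex sets of its members, $S=K[x_{ij}\mid x_{ij}\in V(\mathcal{C})]$ with the standard grading, and $I(\mathcal{C})=(x_{a_1b_1}x_{a_2b_2}-x_{a_1b_2}x_{a_2b_1}\mid[a_1,a_2|b_1,b_2]\in\mathcal{C})\subset S$. A horizontal interval of $\mathcal{C}$ is a set of vertices of $V(\mathcal{C})$ lying in one row of $M$ such that any two of them are joined by a path of horizontal edges of (minors in) $\mathcal{C}$; it is maximal if it is not strictly contained in another horizontal interval. For $U\subset V(\mathcal{C})$, removing $U$ from $\mathcal{C}$ gives $\mathcal{C}\setminus U=\{\delta\in\mathcal{C}\mid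 V(\delta)\cap U=\emptyset\}$; thus $\mathcal{C}'=\mathcal{C}\setminus H_k$, and $I(\mathcal{C}')$ is the ideal of $S$ generated by the binomials of the minors in $\mathcal{C}'$. $\beta_{ij}$ denotes the $(i,j)$-th graded Betti number over $S$. *)

theory Defs
  imports
    "HOL-Library.Poly_Mapping"
    "HOL-Algebra.Module"
    "HOL-Algebra.QuotRing"
    "HOL-Algebra.Ideal_Product"
begin

section \<open>Polynomial rings and their standard grading\<close>

type_synonym ('x, 'k) mpoly = "('x \<Rightarrow>\<^sub>0 nat) \<Rightarrow>\<^sub>0 'k"

definition polynomial_ring :: "'x set \<Rightarrow> ('x, 'k::comm_ring_1) mpoly ring" where
  "polynomial_ring X =
     \<lparr>carrier = {p. \<forall>u \<in> Poly_Mapping.keys p. Poly_Mapping.keys u \<subseteq> X},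
      monoid.mult = (*), one = 1, zero = 0, add = (+)\<rparr>"

definition var :: "'x \<Rightarrow> ('x, 'k::comm_ring_1) mpoly" where
  "var x = Poly_Mapping.single (Poly_Mapping.single x 1) 1"

definition monomial_degree :: "('x \<Rightarrow>\<^sub>0 nat) \<Rightarrow> nat" where
  "monomial_degree u = (\<Sum>x \<in> Poly_Mapping.keys u. Poly_Mapping.lookup u x)"

definition homogeneous_part ::
    "('x, 'k::comm_ring_1) mpoly ring \<Rightarrow> nat \<Rightarrow> ('x, 'k) mpoly set" where
  "homogeneous_part S d =
     {p \<in> carrier S. \<forall>u \<in> Poly_Mapping.keys p. monomial_degree u = d}"

definition irrelevant_ideal ::
    "('x, 'k::comm_ring_1) mpoly ring \<Rightarrow> ('x, 'k) mpoly set" where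
  "irrelevant_ideal S = {p \<in> carrier S. Poly_Mapping.lookup p 0 = 0}"


section \<open>Graded modules and graded Betti numbers\<close>

text \<open>Only modules concentrated in nonnegative degrees are needed; \<open>component M d\<close> is the
  homogeneous component of degree \<open>d\<close>.\<close>

record ('a, 'b) graded_module = "('a, 'b) module" +
  component :: "nat \<Rightarrow> 'b set"

definition quotient_module ::
    "('x, 'k::comm_ring_1) mpoly ring \<Rightarrow> ('x, 'k) mpoly set
      \<Rightarrow> (('x, 'k) mpoly, ('x, 'k) mpoly set) graded_module" where
  "quotient_module S I =
     \<lparr>carrier = carrier (S Quot I),
      monoid.mult = (\<otimes>\<^bsub>S Quot I\<^esub>), one = \<one>\<^bsub>S Quot I\<^esub>,
      zero = \<zero>\<^bsub>S Quot I\<^esub>, add = (\<oplus>\<^bsub>S Quot I\<^esub>),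
      smult = (\<lambda>p A. (I +>\<^bsub>S\<^esub> p) \<otimes>\<^bsub>S Quot I\<^esub> A),
      component = (\<lambda>d. (\<lambda>p. I +>\<^bsub>S\<^esub> p) ` homogeneous_part S d)\<rparr>"

text \<open>The free module \<open>\<Oplus>\<^sub>j S(-j)\<^bsup>b j\<^esup>\<close>. Its basis is indexed by the pairs \<open>(j, k)\<close> with
  \<open>k < b j\<close>, the basis element \<open>(j, k)\<close> having degree \<open>j\<close>. The fields \<open>mult\<close> and \<open>one\<close>, which
  the record type inherits from rings, play no role for modules.\<close>

definition graded_free_module ::
    "('x, 'k::comm_ring_1) mpoly ring \<Rightarrow> (nat \<Rightarrow> nat)
      \<Rightarrow> (('x, 'k) mpoly, nat \<times> nat \<Rightarrow>\<^sub>0 ('x, 'k) mpoly) graded_module" where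
  "graded_free_module S b =
     (let F = {v. Poly_Mapping.keys v \<subseteq> {(j, k). k < b j}
                  \<and> (\<forall>e. Poly_Mapping.lookup v e \<in> carrier S)}
      in \<lparr>carrier = F,
          monoid.mult = undefined, one = undefined,
          zero = 0, add = (+),
          smult = (\<lambda>p. Poly_Mapping.map ((*) p)),
          component = (\<lambda>d. {v \<in> F. \<forall>(j, k) \<in> Poly_Mapping.keys v.
             j \<le> d \<and> Poly_Mapping.lookup v (j, k) \<in> homogeneous_part S (d - j)})\<rparr>)"

definition graded_module_hom ::
    "'a ring \<Rightarrow> ('a, 'b) graded_module \<Rightarrow> ('a, 'c) graded_module \<Rightarrow> ('b \<Rightarrow> 'c) set" where
  "graded_module_hom S M N =
     {f \<in> carrier M \<rightarrow> carrier N.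
        (\<forall>x \<in> carrier M. \<forall>y \<in> carrier M. f (x \<oplus>\<^bsub>M\<^esub> y) = f x \<oplus>\<^bsub>N\<^esub> f y) \<and>
        (\<forall>a \<in> carrier S. \<forall>x \<in> carrier M. f (a \<odot>\<^bsub>M\<^esub> x) = a \<odot>\<^bsub>N\<^esub> f x) \<and>
        (\<forall>d. f ` component M d \<subseteq> component N d)}"

text \<open>The complex
  \<open>\<dots> \<rightarrow> F 2 \<rightarrow> F 1 \<rightarrow> F 0 \<rightarrow> M \<rightarrow> 0\<close> with \<open>F i = \<Oplus>\<^sub>j S(-j)\<^bsup>\<beta> i j\<^esup>\<close>, differentials
  \<open>\<phi> i : F (i + 1) \<rightarrow> F i\<close> and augmentation \<open>\<epsilon> : F 0 \<rightarrow> M\<close> is exact, and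
  \<open>\<phi> i (F (i + 1)) \<subseteq> \<mm> F i\<close> for the irrelevant ideal \<open>\<mm>\<close>.\<close>

definition minimal_graded_free_resolution ::
    "('x, 'k::comm_ring_1) mpoly ring \<Rightarrow> (('x, 'k) mpoly, 'm) graded_module
      \<Rightarrow> (nat \<Rightarrow> nat \<Rightarrow> nat)
      \<Rightarrow> ((nat \<times> nat \<Rightarrow>\<^sub>0 ('x, 'k) mpoly) \<Rightarrow> 'm)
      \<Rightarrow> (nat \<Rightarrow> (nat \<times> nat \<Rightarrow>\<^sub>0 ('x, 'k) mpoly) \<Rightarrow> (nat \<times> nat \<Rightarrow>\<^sub>0 ('x, 'k) mpoly))
      \<Rightarrow> bool" where
  "minimal_graded_free_resolution S M \<beta> \<epsilon> \<phi> \<longleftrightarrow>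
     (let F = (\<lambda>i. graded_free_module S (\<beta> i)) in
        \<epsilon> \<in> graded_module_hom S (F 0) M \<and>
        (\<forall>i. \<phi> i \<in> graded_module_hom S (F (Suc i)) (F i)) \<and>
        \<epsilon> ` carrier (F 0) = carrier M \<and>
        a_kernel (F 0) M \<epsilon> = \<phi> 0 ` carrier (F 1) \<and>
        (\<forall>i. a_kernel (F (Suc i)) (F i) (\<phi> i) = \<phi> (Suc i) ` carrier (F (Suc (Suc i)))) \<and>
        (\<forall>i. \<forall>v \<in> carrier (F (Suc i)). \<forall>e. Poly_Mapping.lookup (\<phi> i v) e \<in> irrelevant_ideal S))"

text \<open>For a finitely generated graded module over a polynomial ring in finitely many variables
  over a field, a minimal graded free resolution exists and is unique up to isomorphism, so the
  choice of \<open>\<beta>\<close> below is unique. Moreover each of its free modules then has finite rank.\<close>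

definition graded_betti ::
    "('x, 'k::field) mpoly ring \<Rightarrow> (('x, 'k) mpoly, 'm) graded_module
      \<Rightarrow> nat \<Rightarrow> nat \<Rightarrow> nat" where
  "graded_betti S M = (SOME \<beta>. \<exists>\<epsilon> \<phi>. minimal_graded_free_resolution S M \<beta> \<epsilon> \<phi>)"


section \<open>Sets of 2-minors\<close>

text \<open>\<open>Minor a\<^sub>1 a\<^sub>2 b\<^sub>1 b\<^sub>2\<close> is \<open>[a\<^sub>1, a\<^sub>2 | b\<^sub>1, b\<^sub>2]\<close>; the indeterminate in row \<open>a\<close> and column \<open>b\<close>
  is indexed by the pair \<open>(a, b)\<close>.\<close>

datatype two_minor = Minor (row1: nat) (row2: nat) (col1: nat) (col2: nat)

definition two_minors :: "nat \<Rightarrow> nat \<Rightarrow> two_minor set" where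
  "two_minors m n =
     {Minor a1 a2 b1 b2 | a1 a2 b1 b2.
        1 \<le> a1 \<and> a1 < a2 \<and> a2 \<le> m \<and> 1 \<le> b1 \<and> b1 < b2 \<and> b2 \<le> n}"

definition corner_interval_minors :: "nat \<Rightarrow> nat \<Rightarrow> two_minor set" where
  "corner_interval_minors m n = {\<delta> \<in> two_minors m n. col1 \<delta> = 1}"

fun minor_vertices :: "two_minor \<Rightarrow> (nat \<times> nat) set" where
  "minor_vertices (Minor a1 a2 b1 b2) = {(a1, b1), (a1, b2), (a2, b1), (a2, b2)}"

fun horizontal_edges :: "two_minor \<Rightarrow> (nat \<times> nat) set set" where
  "horizontal_edges (Minor a1 a2 b1 b2) = {{(a1, b1), (a1, b2)}, {(a2, b1), (a2, b2)}}"

fun minor_binomial :: "two_minor \<Rightarrow> (nat \<times> nat, 'k::comm_ring_1) mpoly" where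
  "minor_binomial (Minor a1 a2 b1 b2) =
     var (a1, b1) * var (a2, b2) - var (a1, b2) * var (a2, b1)"

definition vertices :: "two_minor set \<Rightarrow> (nat \<times> nat) set" where
  "vertices C = (\<Union>\<delta> \<in> C. minor_vertices \<delta>)"

definition minor_ideal ::
    "(nat \<times> nat, 'k::comm_ring_1) mpoly ring \<Rightarrow> two_minor set \<Rightarrow> (nat \<times> nat, 'k) mpoly set" where
  "minor_ideal S C = genideal S (minor_binomial ` C)"

definition horizontal_path_connected ::
    "two_minor set \<Rightarrow> nat \<times> nat \<Rightarrow> nat \<times> nat \<Rightarrow> bool" where
  "horizontal_path_connected C u v \<longleftrightarrow>
     (u, v) \<in> {(x, y). \<exists>\<delta> \<in> C. {x, y} \<in> horizontal_edges \<delta>}\<^sup>*"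

definition horizontal_interval :: "two_minor set \<Rightarrow> (nat \<times> nat) set \<Rightarrow> bool" where
  "horizontal_interval C H \<longleftrightarrow>
     H \<subseteq> vertices C \<and> (\<exists>a. \<forall>x \<in> H. fst x = a) \<and>
     (\<forall>u \<in> H. \<forall>v \<in> H. horizontal_path_connected C u v)"

definition maximal_horizontal_interval :: "two_minor set \<Rightarrow> (nat \<times> nat) set \<Rightarrow> bool" where
  "maximal_horizontal_interval C H \<longleftrightarrow>
     horizontal_interval C H \<and> \<not> (\<exists>H'. horizontal_interval C H' \<and> H \<subset> H')"

definition remove_vertices :: "two_minor set \<Rightarrow> (nat \<times> nat) set \<Rightarrow> two_minor set" where
  "remove_vertices C U = {\<delta> \<in> C. minor_vertices \<delta> \<inter> U = {}}"

end

theory Submission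
  imports Defs "HOL.Vector_Spaces"
begin

text \<open>If \<open>H\<close> is a maximal horizontal interval, then corner-interval minors being joined to the first
  column, \<open>H\<close> consists of all vertices in some row, and \<open>C'\<close> consists of the minors avoiding that
  row. Let \<open>\<rho>\<close> be the retraction of \<open>S\<close> that substitutes \<open>0\<close> for the variables of the row. Then
  \<open>\<rho> (I(C)\<^sup>t) \<subseteq> I(C')\<^sup>t \<subseteq> I(C)\<^sup>t\<close>, and \<open>I(C')\<^sup>t\<close> is generated over the fixed ring of \<open>\<rho>\<close>. By flatness
  \<open>S/I(C')\<^sup>t\<close> has a minimal resolution \<open>G\<close> with matrices over the fixed ring. If \<open>F\<close> is a minimal
  resolution of \<open>S/I(C)\<^sup>t\<close>, the inclusion lifts to a map \<open>G \<rightarrow> F\<close> and \<open>\<rho>\<close> to a semilinear map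
  \<open>F \<rightarrow> G\<close>. The composition is homotopic to \<open>\<rho>\<close>, so by minimality it is the identity modulo the
  irrelevant ideal, and the ranks of \<open>G\<close> are bounded by those of \<open>F\<close>. With \<open>\<rho>\<close> the identity, the
  same argument shows that the ranks do not depend on the choice of a minimal resolution.\<close>

text \<open>\<open>graded_betti\<close> is a value of the choice operator, so nothing is known about
  it before a minimal resolution has been constructed. The resolution \<open>G\<close> with matrices
  over the fixed ring need not be the chosen one, hence the need to compare ranks a second time.

  The comparison itself forces the matrices of \<open>G\<close> to be over the fixed ring: the
  homotopy is between a composite of lifts and \<rho> acting on the coordinates of \<open>G\<close>,
  and \<rho> commutes with the differentials of \<open>G\<close> because it fixes their entries.
  Semilinearity does no harm modulo the irrelevant ideal, since \<rho> preserves constant terms and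
  fixes the basis vectors.

  Each term of the binomial of a minor contains one variable from each of its two rows. So \<rho>
  kills the binomials of the removed minors and fixes the others; being multiplicative, it then
  treats all powers at once.

  Flatness is made elementary: a polynomial is split into coordinates with respect to the monomials
  in the remaining variables, and a matrix over the fixed ring acts on every coordinate separately.
  Hence its kernel is generated by kernel vectors over the fixed ring.\<close>

abbreviation lookup where "lookup \<equiv> Poly_Mapping.lookup"
abbreviation keys where "keys \<equiv> Poly_Mapping.keys"
abbreviation single where "single \<equiv> Poly_Mapping.single"

type_synonym ('x, 'k) fvec = "nat \<times> nat \<Rightarrow>\<^sub>0 ('x, 'k) mpoly"

section \<open>Finitely supported functions, additive maps and additive closures\<close>

lemma poly_mapping_sum_single: "p = (\<Sum>u\<in>keys p. single u (lookup p u))"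
proof (rule poly_mapping_eqI)
  fix k
  show "lookup p k = lookup (\<Sum>u\<in>keys p. single u (lookup p u)) k"
    by (cases "k \<in> keys p") (auto simp: lookup_sum lookup_single when_def in_keys_iff)
qed

lemma poly_mapping_induct [case_names zero add single]:
  fixes p :: "'a \<Rightarrow>\<^sub>0 'b::comm_monoid_add"
  assumes "P 0" and "\<And>p q. P p \<Longrightarrow> P q \<Longrightarrow> P (p + q)" and "\<And>u c. P (single u c)"
  shows "P p"
proof -
  have "P (\<Sum>u\<in>A. single u (lookup p u))" if "finite A" for A
    using that by (induction A) (auto simp: assms)
  then show ?thesis using poly_mapping_sum_single[of p] by (metis finite_keys)
qed

lemma fvec_induct [case_names zero add single]:
  fixes v :: "('x, 'k::comm_ring_1) fvec"
  assumes "P 0" and "\<And>v w. P v \<Longrightarrow> P w \<Longrightarrow> P (v + w)"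
    and "\<And>e u c. P (single e (single u c))"
  shows "P v"
proof (induction v rule: poly_mapping_induct)
  case (single e p)
  show ?case
    by (induction p rule: poly_mapping_induct) (auto simp: assms single_add)
qed (auto simp: assms)

lemma additive_sum:
  fixes f :: "'a::comm_monoid_add \<Rightarrow> 'b::ab_group_add"
  assumes "\<And>x y. f (x + y) = f x + f y"
  shows "f 0 = 0" "f (\<Sum>i\<in>A. g i) = (\<Sum>i\<in>A. f (g i))"
proof -
  show z: "f 0 = 0" using assms[of 0 0] by simp
  show "f (\<Sum>i\<in>A. g i) = (\<Sum>i\<in>A. f (g i))"
    by (induction A rule: infinite_finite_induct) (auto simp: z assms)
qed

lemma additive_diff:
  fixes f :: "'a::ab_group_add \<Rightarrow> 'b::ab_group_add"
  assumes "\<And>x y. f (x + y) = f x + f y"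
  shows "f (x - y) = f x - f y" "f (- x) = - f x"
proof -
  show *: "f (x - y) = f x - f y" for x y using assms[of "x - y" y] by simp
  show "f (- x) = - f x" using *[of 0 x] additive_sum(1)[of f, OF assms] by simp
qed

text \<open>Generation by homogeneous elements, generation over fewer variables and membership in a
  generated ideal all become inclusions in such an additive closure. Where multiples are meant, they
  are put into the set \<open>A\<close> itself.\<close>

inductive_set finite_sums :: "'a::comm_monoid_add set \<Rightarrow> 'a set" for A where
  zero: "0 \<in> finite_sums A"
| add: "a \<in> A \<Longrightarrow> b \<in> finite_sums A \<Longrightarrow> a + b \<in> finite_sums A"

lemma finite_sums_incl: "a \<in> A \<Longrightarrow> a \<in> finite_sums A"
  using finite_sums.add[OF _ finite_sums.zero, of a A] by simp

lemma finite_sums_plus: "a \<in> finite_sums A \<Longrightarrow> b \<in> finite_sums A \<Longrightarrow> a + b \<in> finite_sums A"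
  by (induction rule: finite_sums.induct) (auto intro: finite_sums.intros simp: add.assoc)

lemma finite_sums_sum: "(\<And>i. i \<in> I \<Longrightarrow> f i \<in> finite_sums A) \<Longrightarrow> sum f I \<in> finite_sums A"
  by (induction I rule: infinite_finite_induct) (auto intro: finite_sums.zero finite_sums_plus)

lemma finite_sums_subset:
  assumes "A \<subseteq> N" "0 \<in> N" "\<And>x y. x \<in> N \<Longrightarrow> y \<in> N \<Longrightarrow> x + y \<in> N"
  shows "finite_sums A \<subseteq> N"
proof
  fix x assume "x \<in> finite_sums A" then show "x \<in> N"
    by induction (use assms in auto)
qed

lemma finite_sums_mult:
  fixes A B :: "'a::comm_ring_1 set"
  assumes "x \<in> finite_sums A" "y \<in> finite_sums B" "\<And>a b. a \<in> A \<Longrightarrow> b \<in> B \<Longrightarrow> a * b \<in> finite_sums D"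
  shows "x * y \<in> finite_sums D"
  using assms(1)
proof induction
  case (add a x)
  from assms(2) have "a * y \<in> finite_sums D"
    by induction (auto intro: finite_sums.zero finite_sums_plus assms(3) add simp: distrib_left)
  then show ?case by (simp add: distrib_right finite_sums_plus add)
qed (auto intro: finite_sums.zero)

section \<open>Polynomials\<close>

definition polys :: "'x set \<Rightarrow> ('x, 'k::comm_ring_1) mpoly set" where
  "polys X = {p. \<forall>u \<in> keys p. keys u \<subseteq> X}"

lemma carrier_polynomial_ring [simp]: "carrier (polynomial_ring X) = polys X"
  by (simp add: polynomial_ring_def polys_def)

lemma polys_0 [simp]: "0 \<in> polys X" and polys_1 [simp]: "1 \<in> polys X"
  by (auto simp: polys_def)

lemma polys_add [simp]: "p \<in> polys X \<Longrightarrow> q \<in> polys X \<Longrightarrow> p + q \<in> polys X"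
  using keys_add[of p q] by (auto simp: polys_def)

lemma polys_uminus [simp]: "p \<in> polys X \<Longrightarrow> - p \<in> polys X"
  by (auto simp: polys_def in_keys_iff)

lemma polys_diff [simp]: "p \<in> polys X \<Longrightarrow> q \<in> polys X \<Longrightarrow> p - q \<in> polys X"
  using polys_add[of p X "- q"] by simp

lemma keys_add_nat: "keys (u + w) = keys u \<union> keys (w :: 'x \<Rightarrow>\<^sub>0 nat)"
  by (auto simp: in_keys_iff lookup_add)

lemma polys_mult [simp]: "p \<in> polys X \<Longrightarrow> q \<in> polys X \<Longrightarrow> p * q \<in> polys X"
  using keys_mult[of p q] by (fastforce simp: polys_def keys_add_nat)

lemma polys_single: "keys u \<subseteq> X \<Longrightarrow> single u c \<in> polys X"
  by (auto simp: polys_def)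

lemma polys_const [simp]: "single 0 c \<in> polys X"
  by (auto simp: polys_def)

lemma polys_mono: "X \<subseteq> Y \<Longrightarrow> p \<in> polys X \<Longrightarrow> p \<in> polys Y"
  by (auto simp: polys_def)

lemma polys_induct [consumes 1, case_names zero add single]:
  assumes "p \<in> polys X" and "P 0" and "\<And>p q. P p \<Longrightarrow> P q \<Longrightarrow> P (p + q)"
    and "\<And>u c. keys u \<subseteq> X \<Longrightarrow> P (single u c)"
  shows "P p"
proof -
  have "P (\<Sum>u\<in>A. single u (lookup p u))" if "finite A" "A \<subseteq> keys p" for A
    using that assms(1) by (induction A) (auto simp: assms(2-) polys_def)
  then show ?thesis using poly_mapping_sum_single[of p] by (metis finite_keys order_refl)
qed

text \<open>The residue map modulo the irrelevant ideal, a ring homomorphism by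
  \<open>const_coeff_mult\<close>. Minimality of a resolution means that it annihilates all entries
  of the differentials.\<close>

definition const_coeff :: "('x, 'k::comm_ring_1) mpoly \<Rightarrow> 'k" where
  "const_coeff p = lookup p 0"

lemma add_eq_0_nat: "u + w = 0 \<longleftrightarrow> u = 0 \<and> w = (0 :: 'x \<Rightarrow>\<^sub>0 nat)"
  by (auto simp: poly_mapping_eq_iff lookup_add fun_eq_iff)

lemma const_coeff_add [simp]: "const_coeff (p + q) = const_coeff p + const_coeff q"
  and const_coeff_0 [simp]: "const_coeff 0 = 0" and const_coeff_1 [simp]: "const_coeff 1 = 1"
  by (auto simp: const_coeff_def lookup_add lookup_one)

lemma const_coeff_diff [simp]: "const_coeff (p - q) = const_coeff p - const_coeff q"
  by (simp add: const_coeff_def lookup_minus)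

lemma const_coeff_single: "const_coeff (single u c) = (if u = 0 then c else 0)"
  by (simp add: const_coeff_def lookup_single when_def)

lemma const_coeff_mult [simp]: "const_coeff (p * q) = const_coeff p * const_coeff q"
proof (induction p rule: poly_mapping_induct)
  case (single u c)
  show ?case
    by (induction q rule: poly_mapping_induct) (auto simp: mult_single const_coeff_single add_eq_0_nat algebra_simps)
qed (auto simp: algebra_simps)

lemma const_coeff_sum: "const_coeff (sum f I) = (\<Sum>i\<in>I. const_coeff (f i))"
  by (rule additive_sum) simp

section \<open>Splitting monomials and polynomials along a set of variables\<close>

definition restrict_monomial :: "'x set \<Rightarrow> ('x \<Rightarrow>\<^sub>0 nat) \<Rightarrow> ('x \<Rightarrow>\<^sub>0 nat)" where
  "restrict_monomial A u = Poly_Mapping.mapp (\<lambda>x n. n when x \<in> A) u"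

lemma lookup_restrict_monomial: "lookup (restrict_monomial A u) x = (lookup u x when x \<in> A)"
  by (auto simp: restrict_monomial_def lookup_mapp in_keys_iff when_def)

lemma restrict_monomial_add: "restrict_monomial A (u + w) = restrict_monomial A u + restrict_monomial A w"
  by (rule poly_mapping_eqI) (auto simp: lookup_restrict_monomial lookup_add when_def)

lemma restrict_monomial_split: "restrict_monomial A u + restrict_monomial (- A) u = u"
  by (rule poly_mapping_eqI) (auto simp: lookup_restrict_monomial lookup_add when_def)

lemma keys_restrict_monomial: "keys (restrict_monomial A u) = keys u \<inter> A"
  by (auto simp: in_keys_iff lookup_restrict_monomial when_def split: if_splits)

lemma restrict_monomial_id: "keys u \<subseteq> A \<Longrightarrow> restrict_monomial A u = u"
  by (rule poly_mapping_eqI) (auto simp: lookup_restrict_monomial when_def in_keys_iff)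

lemma restrict_monomial_0: "keys u \<inter> A = {} \<Longrightarrow> restrict_monomial A u = 0"
  by (rule poly_mapping_eqI) (auto simp: lookup_restrict_monomial when_def in_keys_iff)

lemma restrict_monomial_compl: "keys u \<subseteq> A \<Longrightarrow> restrict_monomial (- A) u = 0"
  by (rule restrict_monomial_0) auto

text \<open>Over the subring in the variables of \<open>A\<close>, the monomials in the other variables are a basis
  of the polynomial ring; \<open>slice A u p\<close> is the coordinate of \<open>p\<close> at the monomial \<open>u\<close>.
  In particular \<open>slice A 0\<close> substitutes \<open>0\<close> for the variables outside \<open>A\<close>.\<close>

definition slice :: "'x set \<Rightarrow> ('x \<Rightarrow>\<^sub>0 nat) \<Rightarrow> ('x, 'k::comm_ring_1) mpoly \<Rightarrow> ('x, 'k) mpoly" where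
  "slice A u p = (\<Sum>w\<in>keys p. if restrict_monomial (- A) w = u then single (restrict_monomial A w) (lookup p w) else 0)"

lemma slice_add [simp]: "slice A u (p + q) = slice A u p + slice A u q"
  unfolding slice_def by (rule setsum_keys_plus_distrib) (auto simp: single_add)

lemma slice_0 [simp]: "slice A u 0 = 0" by (simp add: slice_def)

lemma slice_single:
  "slice A u (single w c) = (if restrict_monomial (- A) w = u then single (restrict_monomial A w) c else 0)"
  by (cases "c = 0") (auto simp: slice_def)

lemma slice_sum: "slice A u (sum f I) = (\<Sum>i\<in>I. slice A u (f i))"
  by (rule additive_sum) simp

lemma slice_polys: "p \<in> polys X \<Longrightarrow> slice A u p \<in> polys (X \<inter> A)"
  by (induction p rule: polys_induct)
    (auto simp: slice_single keys_restrict_monomial intro!: polys_single)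

lemma slice_polys': "slice A u p \<in> polys A"
  by (induction p rule: poly_mapping_induct) (auto simp: slice_single keys_restrict_monomial intro!: polys_single)

text \<open>Multiplication by a monomial in the variables of \<open>A\<close> leaves the
  off-\<open>A\<close> part of a monomial unchanged, so taking a coordinate is linear over
  \<open>polys A\<close>.\<close>

lemma slice_mult_left:
  assumes "q \<in> polys A"
  shows "slice A u (q * p) = q * slice A u p"
  using assms
proof (induction q rule: polys_induct)
  case (single w c)
  then have w: "restrict_monomial A w = w" "restrict_monomial (- A) w = 0" by (auto intro: restrict_monomial_id restrict_monomial_0)
  show ?case
    by (induction p rule: poly_mapping_induct)
      (auto simp: mult_single slice_single restrict_monomial_add w algebra_simps)
qed (auto simp: algebra_simps)

lemma slice_0_id: "p \<in> polys A \<Longrightarrow> slice A 0 p = p"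
  by (induction p rule: polys_induct) (auto simp: slice_single restrict_monomial_id restrict_monomial_compl)

lemma slice_1 [simp]: "slice A 0 1 = 1"
  by (simp add: slice_0_id)

text \<open>Off-\<open>A\<close> parts add under multiplication, and natural exponents add up to
  \<open>0\<close> only if both vanish. This makes \<open>slice A 0\<close> a ring
  endomorphism.\<close>

lemma slice_0_mult [simp]: "slice A 0 (p * q) = slice A 0 p * slice A 0 q"
proof (induction p rule: poly_mapping_induct)
  case (single u c)
  show ?case
    by (induction q rule: poly_mapping_induct)
      (auto simp: mult_single slice_single restrict_monomial_add add_eq_0_nat algebra_simps)
qed (auto simp: algebra_simps)

lemma const_coeff_slice_0 [simp]: "const_coeff (slice A 0 p) = const_coeff p"
proof (induction p rule: poly_mapping_induct)
  case (single u c)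
  have "u = 0" if "restrict_monomial (- A) u = 0" "restrict_monomial A u = 0"
    using restrict_monomial_split[of A u] that by simp
  then show ?case by (auto simp: slice_single const_coeff_single restrict_monomial_0)
qed auto

definition off_monomials :: "'x set \<Rightarrow> ('x, 'k::comm_ring_1) mpoly \<Rightarrow> ('x \<Rightarrow>\<^sub>0 nat) set" where
  "off_monomials A p = restrict_monomial (- A) ` keys p"

text \<open>The monomials of \<open>p\<close> are grouped by their off-\<open>A\<close> part.
  Admitting any finite \<open>U\<close> above \<open>off_monomials A p\<close> lets one index set
  serve all entries of a vector.\<close>

lemma slice_expansion:
  assumes "finite U" "off_monomials A p \<subseteq> U"
  shows "(\<Sum>u\<in>U. single u 1 * slice A u p) = p"
proof -
  have *: "(\<Sum>u\<in>U. single u 1 * slice A u (single w c)) = single w c"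
    if "restrict_monomial (- A) w \<in> U" for w and c :: 'b
  proof -
    have "(\<Sum>u\<in>U. single u 1 * slice A u (single w c))
        = (\<Sum>u\<in>U. if u = restrict_monomial (- A) w then single w c else 0)"
      by (rule sum.cong) (auto simp: slice_single mult_single, metis add.commute restrict_monomial_split)
    also have "\<dots> = single w c" using that assms(1) by simp
    finally show ?thesis .
  qed
  have "(\<Sum>u\<in>U. single u 1 * slice A u p)
      = (\<Sum>u\<in>U. single u 1 * slice A u (\<Sum>w\<in>keys p. single w (lookup p w)))"
    using poly_mapping_sum_single[of p] by simp
  also have "\<dots> = (\<Sum>w\<in>keys p. \<Sum>u\<in>U. single u 1 * slice A u (single w (lookup p w)))"
    by (simp add: slice_sum sum_distrib_left) (rule sum.swap)
  also have "\<dots> = (\<Sum>w\<in>keys p. single w (lookup p w))"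
    using assms(2) by (intro sum.cong *) (auto simp: off_monomials_def)
  finally show ?thesis using poly_mapping_sum_single[of p] by simp
qed

lemma monomial_degree_add: "monomial_degree (u + w) = monomial_degree u + monomial_degree w"
  unfolding monomial_degree_def by (rule setsum_keys_plus_distrib) auto

lemma monomial_degree_eq_0: "monomial_degree u = 0 \<longleftrightarrow> u = 0"
  by (auto simp: monomial_degree_def in_keys_iff simp flip: keys_eq_empty)

text \<open>Every exponent is bounded by the degree, so the monomials embed into the functions from
  a finite set to \<open>{..d}\<close>. Graded components become finite-dimensional in this
  way.\<close>

lemma finite_monomials:
  assumes "finite X"
  shows "finite {u :: 'x \<Rightarrow>\<^sub>0 nat. keys u \<subseteq> X \<and> monomial_degree u \<le> d}" (is "finite ?M")
proof -
  have "lookup u x \<le> d" if "keys u \<subseteq> X" "monomial_degree u \<le> d" for u :: "'x \<Rightarrow>\<^sub>0 nat" and x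
  proof (cases "x \<in> keys u")
    case True
    then have "lookup u x \<le> monomial_degree u"
      unfolding monomial_degree_def by (intro member_le_sum) auto
    then show ?thesis using that by simp
  qed (simp add: in_keys_iff)
  then have "lookup ` ?M \<subseteq> {f. \<forall>x. (x \<in> X \<longrightarrow> f x \<in> {..d}) \<and> (x \<notin> X \<longrightarrow> f x = 0)}"
    by (auto simp: in_keys_iff)
  moreover have "finite \<dots>" using assms by (intro finite_set_of_finite_funs) auto
  ultimately have "finite (lookup ` ?M)" by (rule finite_subset)
  then show ?thesis by (rule finite_imageD) (auto simp: inj_on_def)
qed

section \<open>Free modules\<close>

definition vscale :: "('x, 'k::comm_ring_1) mpoly \<Rightarrow> ('x, 'k) fvec \<Rightarrow> ('x, 'k) fvec" where
  "vscale p = Poly_Mapping.map ((*) p)"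

lemma lookup_map0: "h 0 = 0 \<Longrightarrow> lookup (Poly_Mapping.map h v) e = h (lookup v e)"
  by (simp add: map.rep_eq when_def)

lemma lookup_vscale [simp]: "lookup (vscale p v) e = p * lookup v e"
  by (simp add: vscale_def lookup_map0)

lemma vscale_simps [simp]:
  "vscale p (v + w) = vscale p v + vscale p w" "vscale (p + q) v = vscale p v + vscale q v"
  "vscale p (vscale q v) = vscale (p * q) v" "vscale 1 v = v" "vscale 0 v = 0" "vscale p 0 = 0"
  "vscale p (v - w) = vscale p v - vscale p w" "vscale p (- v) = - vscale p v" "vscale (- p) v = - vscale p v"
  "vscale p (single e q) = single e (p * q)"
  by (rule poly_mapping_eqI;
      simp add: lookup_add lookup_minus lookup_single when_def algebra_simps)+

lemma vscale_sum_left: "vscale (sum f I) v = (\<Sum>i\<in>I. vscale (f i) v)"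
  by (rule additive_sum(2)[where f = "\<lambda>p. vscale p v"]) simp

text \<open>Scalars enter as constant polynomials, so that the vector space library applies to the
  graded pieces of free modules.\<close>

definition kscale :: "'k::field \<Rightarrow> ('x, 'k) fvec \<Rightarrow> ('x, 'k) fvec" where
  "kscale c = vscale (single 0 c)"

interpretation K: vector_space kscale
  by standard (simp_all add: kscale_def single_add mult_single)

definition basis_vec :: "nat \<times> nat \<Rightarrow> ('x, 'k::comm_ring_1) fvec" where
  "basis_vec e = single e 1"

lemma vscale_basis_vec [simp]: "vscale p (basis_vec e) = single e p"
  by (simp add: basis_vec_def)

lemma fvec_sum_basis_vec: "v = (\<Sum>e\<in>keys v. vscale (lookup v e) (basis_vec e))"
  using poly_mapping_sum_single[of v] by simp

definition basis_index :: "(nat \<Rightarrow> nat) \<Rightarrow> (nat \<times> nat) set" where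
  "basis_index b = {(j, k). k < b j}"

definition free_vecs :: "'x set \<Rightarrow> (nat \<Rightarrow> nat) \<Rightarrow> ('x, 'k::comm_ring_1) fvec set" where
  "free_vecs X b = {v. keys v \<subseteq> basis_index b \<and> (\<forall>e. lookup v e \<in> polys X)}"

lemma free_vecs_0 [simp]: "0 \<in> free_vecs X b" by (simp add: free_vecs_def)

lemma free_vecs_add [simp]: "v \<in> free_vecs X b \<Longrightarrow> w \<in> free_vecs X b \<Longrightarrow> v + w \<in> free_vecs X b"
  using keys_add[of v w] by (auto simp: free_vecs_def lookup_add)

lemma free_vecs_vscale [simp]: "p \<in> polys X \<Longrightarrow> v \<in> free_vecs X b \<Longrightarrow> vscale p v \<in> free_vecs X b"
proof -
  assume "p \<in> polys X" and v: "v \<in> free_vecs X b"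
  moreover have "keys (vscale p v) \<subseteq> keys v"
    by (auto simp: in_keys_iff)
  ultimately show ?thesis unfolding free_vecs_def by auto
qed

lemma free_vecs_uminus [simp]: "w \<in> free_vecs X b \<Longrightarrow> - w \<in> free_vecs X b"
  using free_vecs_vscale[of "- 1" X w b] by (simp del: free_vecs_vscale)

lemma free_vecs_diff [simp]: "v \<in> free_vecs X b \<Longrightarrow> w \<in> free_vecs X b \<Longrightarrow> v - w \<in> free_vecs X b"
  using free_vecs_add[of v X b "- w"] by simp

lemma free_vecs_single [simp]: "e \<in> basis_index b \<Longrightarrow> p \<in> polys X \<Longrightarrow> single e p \<in> free_vecs X b"
  by (auto simp: free_vecs_def lookup_single when_def)

lemma free_vecs_basis_vec [simp]: "e \<in> basis_index b \<Longrightarrow> basis_vec e \<in> free_vecs X b"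
  by (simp add: basis_vec_def)

lemma free_vecs_mono: "X \<subseteq> Y \<Longrightarrow> v \<in> free_vecs X b \<Longrightarrow> v \<in> free_vecs Y b"
  unfolding free_vecs_def using polys_mono by blast

lemma free_vecs_induct [consumes 1, case_names zero add basis_vec]:
  assumes "v \<in> free_vecs X b" and "P 0" and "\<And>v w. P v \<Longrightarrow> P w \<Longrightarrow> P (v + w)"
    and "\<And>e p. e \<in> basis_index b \<Longrightarrow> p \<in> polys X \<Longrightarrow> P (vscale p (basis_vec e))"
  shows "P v"
proof -
  have "P (\<Sum>e\<in>A. vscale (lookup v e) (basis_vec e))" if "finite A" "A \<subseteq> keys v" for A
    using that
  proof (induction A)
    case (insert e A)
    have "P (vscale (lookup v e) (basis_vec e))"
      using insert.prems assms(1) unfolding free_vecs_def by (intro assms(4)) blast+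
    then show ?case using insert assms(3) by (simp del: vscale_basis_vec)
  qed (simp add: assms(2))
  from this[of "keys v"] show ?thesis using fvec_sum_basis_vec[of v, symmetric] by simp
qed

section \<open>Coordinates of vectors over a subring\<close>

definition vslice :: "'x set \<Rightarrow> ('x \<Rightarrow>\<^sub>0 nat) \<Rightarrow> ('x, 'k::comm_ring_1) fvec \<Rightarrow> ('x, 'k) fvec" where
  "vslice A u = Poly_Mapping.map (slice A u)"

lemma lookup_vslice [simp]: "lookup (vslice A u v) e = slice A u (lookup v e)"
  by (simp add: vslice_def lookup_map0)

lemma vslice_add [simp]: "vslice A u (v + w) = vslice A u v + vslice A u w"
  by (rule poly_mapping_eqI) (simp add: lookup_add)

lemma vslice_0 [simp]: "vslice A u 0 = 0"
  by (rule poly_mapping_eqI) simp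

text \<open>Here the vector is over \<open>polys A\<close> and the scalar is arbitrary, so the
  coordinate falls on the scalar. The vector will be a column of a matrix over
  \<open>polys A\<close>.\<close>

lemma vslice_vscale_right: "(\<And>e. lookup v e \<in> polys A) \<Longrightarrow> vslice A u (vscale p v) = vscale (slice A u p) v"
  by (rule poly_mapping_eqI) (simp add: slice_mult_left mult.commute[of p] mult.commute[of "slice A u p"])

lemma vslice_0_vscale: "vslice A 0 (vscale p v) = vscale (slice A 0 p) (vslice A 0 v)"
  by (rule poly_mapping_eqI) simp

lemma vslice_0_id: "(\<And>e. lookup v e \<in> polys A) \<Longrightarrow> vslice A 0 v = v"
  by (rule poly_mapping_eqI) (simp add: slice_0_id)

lemma vslice_free_vecs: "v \<in> free_vecs X b \<Longrightarrow> vslice A u v \<in> free_vecs (X \<inter> A) b"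
proof -
  assume v: "v \<in> free_vecs X b"
  have "keys (vslice A u v) \<subseteq> keys v"
    by (auto simp: in_keys_iff)
  then show ?thesis using v unfolding free_vecs_def by (auto simp: slice_polys)
qed

text \<open>The off-\<open>A\<close> monomials of all entries together form a common
  \<open>U\<close>. The last clause keeps the multipliers in \<open>polys X\<close>, as needed
  inside a submodule over \<open>polys X\<close>.\<close>

lemma vslice_expansion:
  "\<exists>U. finite U \<and> (\<Sum>u\<in>U. vscale (single u 1) (vslice A u v)) = v \<and> (v \<in> free_vecs X b \<longrightarrow> (\<forall>u\<in>U. keys u \<subseteq> X))"
proof -
  define U where "U = (\<Union>e\<in>keys v. off_monomials A (lookup v e))"
  have fin: "finite U" by (auto simp: U_def off_monomials_def)
  have "(\<Sum>u\<in>U. vscale (single u 1) (vslice A u v)) = v"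
  proof (rule poly_mapping_eqI)
    fix e
    show "lookup (\<Sum>u\<in>U. vscale (single u 1) (vslice A u v)) e = lookup v e"
    proof (cases "e \<in> keys v")
      case True
      then have "off_monomials A (lookup v e) \<subseteq> U" by (auto simp: U_def)
      from slice_expansion[OF fin this] show ?thesis by (simp add: lookup_sum)
    qed (simp add: lookup_sum in_keys_iff)
  qed
  moreover have "\<forall>u\<in>U. keys u \<subseteq> X" if "v \<in> free_vecs X b"
    using that by (fastforce simp: U_def off_monomials_def keys_restrict_monomial free_vecs_def polys_def)
  ultimately show ?thesis using fin by blast
qed

section \<open>Homogeneous vectors and degree projections; the basis element \<open>e\<close> has
  degree \<open>fst e\<close>\<close>

definition vhom :: "nat \<Rightarrow> ('x, 'k::comm_ring_1) fvec \<Rightarrow> bool" where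
  "vhom d v \<longleftrightarrow> (\<forall>e u. lookup (lookup v e) u \<noteq> 0 \<longrightarrow> fst e + monomial_degree u = d)"

definition vproj :: "nat \<Rightarrow> ('x, 'k::comm_ring_1) fvec \<Rightarrow> ('x, 'k) fvec" where
  "vproj d = Poly_Mapping.mapp
     (\<lambda>e. Poly_Mapping.mapp (\<lambda>u c. c when fst e + monomial_degree u = d))"

lemma lookup_vproj: "lookup (lookup (vproj d v) e) u
    = (lookup (lookup v e) u when fst e + monomial_degree u = d)"
  by (auto simp: vproj_def lookup_mapp when_def in_keys_iff)

lemma fvec_eqI: "(\<And>e u. lookup (lookup v e) u = lookup (lookup w e) u) \<Longrightarrow> v = w"
  by (meson poly_mapping_eqI)

lemma vproj_add [simp]: "vproj d (v + w) = vproj d v + vproj d w"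
  by (rule fvec_eqI) (auto simp: lookup_vproj lookup_add when_def)

lemma vproj_0 [simp]: "vproj d 0 = 0"
  by (rule fvec_eqI) (auto simp: lookup_vproj)

lemma vproj_diff [simp]: "vproj d (v - w) = vproj d v - vproj d w"
  by (rule fvec_eqI) (auto simp: lookup_vproj lookup_minus when_def)

lemma vhom_vproj [simp]: "vhom d (vproj d v)"
  by (auto simp: vhom_def lookup_vproj when_def)

lemma vproj_vhom: "vhom k v \<Longrightarrow> vproj d v = (if k = d then v else 0)"
proof (rule fvec_eqI)
  fix e u
  assume "vhom k v"
  then have "lookup (lookup v e) u \<noteq> 0 \<longrightarrow> fst e + monomial_degree u = k"
    unfolding vhom_def by blast
  then show "lookup (lookup (vproj d v) e) u = lookup (lookup (if k = d then v else 0) e) u"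
    by (auto simp: lookup_vproj when_def)
qed

lemma vhom_iff: "vhom d v \<longleftrightarrow> vproj d v = v"
  by (metis vhom_vproj vproj_vhom)

lemma vhom_0 [simp]: "vhom d 0" by (simp add: vhom_def)

lemma lookup_single_mult:
  fixes q :: "('x, 'k::comm_ring_1) mpoly"
  shows "lookup (single u c * q) w \<noteq> 0 \<Longrightarrow> \<exists>w'. w = u + w' \<and> lookup q w' \<noteq> 0"
proof -
  assume "lookup (single u c * q) w \<noteq> 0"
  then have "w \<in> keys (single u c * q)" by (simp add: in_keys_iff)
  then show ?thesis using keys_mult[of "single u c" q]
    by (auto simp: in_keys_iff lookup_single when_def split: if_splits)
qed

lemma vhom_vscale_single: "vhom k v \<Longrightarrow> vhom (monomial_degree u + k) (vscale (single u c) v)"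
  unfolding vhom_def by (fastforce dest!: lookup_single_mult simp: monomial_degree_add)

lemma vhom_single_single: "vhom (fst e + monomial_degree u) (single e (single u c))"
  by (auto simp: vhom_def lookup_single when_def split: if_splits)

lemma vhom_basis_vec [simp]: "vhom (fst e) (basis_vec e)"
  using vhom_single_single[of e 0 1] by (simp add: basis_vec_def monomial_degree_def)

lemma vproj_free_vecs: "v \<in> free_vecs X b \<Longrightarrow> vproj d v \<in> free_vecs X b"
proof -
  assume v: "v \<in> free_vecs X b"
  have "keys (vproj d v) \<subseteq> keys v"
    unfolding vproj_def by (rule keys_mapp_subset)
  moreover have "keys (lookup (vproj d v) e) \<subseteq> keys (lookup v e)" for e
    by (auto simp: in_keys_iff lookup_vproj)
  ultimately show ?thesis using v unfolding free_vecs_def polys_def by blast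
qed

lemma vproj_expansion: "\<exists>D. finite D \<and> (\<Sum>d\<in>D. vproj d v) = v"
proof -
  define D where "D = (\<Union>e\<in>keys v. (\<lambda>u. fst e + monomial_degree u) ` keys (lookup v e))"
  have "finite D" by (auto simp: D_def)
  moreover have "(\<Sum>d\<in>D. vproj d v) = v"
  proof (rule fvec_eqI)
    fix e u
    have "lookup (lookup (\<Sum>d\<in>D. vproj d v) e) u
        = (\<Sum>d\<in>D. if d = fst e + monomial_degree u then lookup (lookup v e) u else 0)"
      by (simp add: lookup_sum lookup_vproj when_def eq_commute[of _ "fst e + monomial_degree u"])
    also have "\<dots> = lookup (lookup v e) u"
    proof (cases "lookup (lookup v e) u = 0")
      case False
      then have "fst e + monomial_degree u \<in> D"
        by (auto simp: D_def in_keys_iff intro!: bexI[of _ e] image_eqI[of _ _ u])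
      then show ?thesis using \<open>finite D\<close> by simp
    qed (auto intro: sum.neutral)
    finally show "lookup (lookup (\<Sum>d\<in>D. vproj d v) e) u = lookup (lookup v e) u" .
  qed
  ultimately show ?thesis by blast
qed

section \<open>Semilinear maps\<close>

text \<open>Semilinear with respect to the ring endomorphism \<open>slice A 0\<close>, which is the identity for
  \<open>A = UNIV\<close>.\<close>

definition semilinear :: "'x set \<Rightarrow> (('x, 'k::comm_ring_1) fvec \<Rightarrow> ('x, 'k) fvec) \<Rightarrow> bool" where
  "semilinear A f \<longleftrightarrow> (\<forall>v w. f (v + w) = f v + f w) \<and> (\<forall>p v. f (vscale p v) = vscale (slice A 0 p) (f v))"

lemma slice_UNIV [simp]: "slice UNIV 0 p = p"
  by (simp add: slice_0_id polys_def)

lemma slinD: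
  assumes "semilinear A f"
  shows "f (v + w) = f v + f w" "f (vscale p v) = vscale (slice A 0 p) (f v)" "f 0 = 0"
    "f (v - w) = f v - f w" "f (- v) = - f v" "f (sum g I) = (\<Sum>i\<in>I. f (g i))"
  using assms additive_sum[of f] additive_diff[of f] by (auto simp: semilinear_def)

lemma linD: "semilinear UNIV f \<Longrightarrow> f (vscale p v) = vscale p (f v)"
  by (simp add: slinD)

lemma semilinear_comp: "semilinear A f \<Longrightarrow> semilinear UNIV g \<Longrightarrow> semilinear A (\<lambda>v. f (g v))"
  "semilinear A f \<Longrightarrow> semilinear UNIV g \<Longrightarrow> semilinear A (\<lambda>v. g (f v))"
  by (auto simp: semilinear_def)

lemma semilinear_diff: "semilinear A f \<Longrightarrow> semilinear A g \<Longrightarrow> semilinear A (\<lambda>v. f v - g v)"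
  by (auto simp: semilinear_def)

lemma semilinear_id [simp]: "semilinear UNIV (\<lambda>v. v)"
  by (simp add: semilinear_def)

lemma semilinear_zero [simp]: "semilinear A (\<lambda>v. 0)"
  by (simp add: semilinear_def)

lemma semilinear_vslice [simp]: "semilinear A (vslice A 0)"
  by (simp add: semilinear_def vslice_0_vscale)

lemma semilinear_expand: "semilinear A f \<Longrightarrow> f v = (\<Sum>e\<in>keys v. vscale (slice A 0 (lookup v e)) (f (basis_vec e)))"
proof -
  assume f: "semilinear A f"
  have "f v = f (\<Sum>e\<in>keys v. vscale (lookup v e) (basis_vec e))"
    using fvec_sum_basis_vec[of v] by simp
  also have "\<dots> = (\<Sum>e\<in>keys v. vscale (slice A 0 (lookup v e)) (f (basis_vec e)))"
    by (simp add: slinD[OF f] del: vscale_basis_vec)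
  finally show ?thesis .
qed

definition semilinear_ext :: "'x set \<Rightarrow> (nat \<times> nat \<Rightarrow> ('x, 'k::comm_ring_1) fvec) \<Rightarrow> ('x, 'k) fvec \<Rightarrow> ('x, 'k) fvec" where
  "semilinear_ext A g v = (\<Sum>e\<in>keys v. vscale (slice A 0 (lookup v e)) (g e))"

lemma semilinear_ext_add: "semilinear_ext A g (v + w) = semilinear_ext A g v + semilinear_ext A g w"
  unfolding semilinear_ext_def by (rule setsum_keys_plus_distrib) auto

lemma semilinear_ext_single: "semilinear_ext A g (single e p) = vscale (slice A 0 p) (g e)"
  by (cases "p = 0") (auto simp: semilinear_ext_def)

lemma semilinear_semilinear_ext [simp]: "semilinear A (semilinear_ext A g)"
proof -
  have "semilinear_ext A g (vscale p v) = vscale (slice A 0 p) (semilinear_ext A g v)" for p v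
    by (induction v rule: poly_mapping_induct) (auto simp: semilinear_ext_add semilinear_ext_single, simp add: semilinear_ext_def)
  then show ?thesis by (simp add: semilinear_def semilinear_ext_add)
qed

lemma semilinear_ext_basis_vec [simp]: "semilinear_ext A g (basis_vec e) = g e"
  by (simp add: basis_vec_def semilinear_ext_single)

lemma semilinear_free_vecs:
  assumes "semilinear A f" "\<And>e. e \<in> basis_index b \<Longrightarrow> f (basis_vec e) \<in> free_vecs X b'" "v \<in> free_vecs X b"
  shows "f v \<in> free_vecs X b'"
  using assms(3)
proof (induction rule: free_vecs_induct)
  case (basis_vec e p)
  have "slice A 0 p \<in> polys X"
    using slice_polys[OF basis_vec(2)] polys_mono by (metis Int_lower1)
  then show ?case using assms(1,2) basis_vec slinD(2)[OF assms(1), of p "basis_vec e"] by simp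
qed (auto simp: slinD[OF assms(1)])

text \<open>The substitution sends a monomial term to itself or to \<open>0\<close>, so it does not
  disturb degrees, and the degrees of the images of basis vectors decide.\<close>

lemma semilinear_vproj:
  assumes "semilinear A f" "\<And>e. vhom (fst e) (f (basis_vec e))"
  shows "vproj d (f v) = f (vproj d v)"
proof (induction v rule: fvec_induct)
  case (single e u c)
  have "f (single e (single u c)) = vscale (slice A 0 (single u c)) (f (basis_vec e))"
    using slinD(2)[OF assms(1), of "single u c" "basis_vec e"] by simp
  also have "slice A 0 (single u c) = single u (if restrict_monomial (- A) u = 0 then c else 0)"
    using restrict_monomial_split[of A u] by (auto simp: slice_single)
  finally have "vhom (monomial_degree u + fst e) (f (single e (single u c)))"
    by (simp only: vhom_vscale_single assms(2))
  moreover have "vhom (monomial_degree u + fst e) (single e (single u c))"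
    using vhom_single_single[of e u c] by (simp add: add.commute)
  ultimately show ?case by (auto simp: vproj_vhom slinD[OF assms(1)])
qed (auto simp: slinD[OF assms(1)])

lemma semilinear_vhom:
  assumes "semilinear A f" "\<And>e. vhom (fst e) (f (basis_vec e))" "vhom d v"
  shows "vhom d (f v)"
  using semilinear_vproj[OF assms(1,2), of d v] assms(3) by (simp add: vhom_iff)

text \<open>The elementary form of flatness: a matrix over \<open>polys A\<close> acts on each
  coordinate separately. For \<open>u = 0\<close> it says that the substitution commutes with the
  matrix.\<close>

lemma lin_vslice:
  assumes "semilinear UNIV f" "\<And>e e'. lookup (f (basis_vec e)) e' \<in> polys A"
  shows "vslice A u (f v) = f (vslice A u v)"
proof (induction v rule: poly_mapping_induct)
  case (single e p)
  have *: "f (single e p) = vscale p (f (basis_vec e))" for p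
    using linD[OF assms(1), of p "basis_vec e"] by simp
  have "vslice A u (single e p) = single e (slice A u p)"
    by (rule poly_mapping_eqI) (simp add: lookup_single when_def)
  then show ?case by (simp add: * vslice_vscale_right assms(2))
qed (auto simp: slinD[OF assms(1)])

declare split_paired_All [simp del] split_paired_Ex [simp del]

section \<open>Existence of minimal resolutions\<close>

definition submod :: "'x set \<Rightarrow> ('x, 'k::comm_ring_1) fvec set \<Rightarrow> bool" where
  "submod X N \<longleftrightarrow> 0 \<in> N \<and> (\<forall>v\<in>N. \<forall>w\<in>N. v + w \<in> N) \<and> (\<forall>p\<in>polys X. \<forall>v\<in>N. vscale p v \<in> N)"

lemma submodD:
  assumes "submod X N"
  shows "0 \<in> N" "v \<in> N \<Longrightarrow> w \<in> N \<Longrightarrow> v + w \<in> N" "p \<in> polys X \<Longrightarrow> v \<in> N \<Longrightarrow> vscale p v \<in> N"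
    "v \<in> N \<Longrightarrow> - v \<in> N" "v \<in> N \<Longrightarrow> w \<in> N \<Longrightarrow> v - w \<in> N"
    "(\<And>i. i \<in> I \<Longrightarrow> h i \<in> N) \<Longrightarrow> sum h I \<in> N"
proof -
  note * = assms[unfolded submod_def]
  show "0 \<in> N" "v \<in> N \<Longrightarrow> w \<in> N \<Longrightarrow> v + w \<in> N" "p \<in> polys X \<Longrightarrow> v \<in> N \<Longrightarrow> vscale p v \<in> N" for v w p
    using * by auto
  show m: "- v \<in> N" if "v \<in> N" for v
    using that conjunct2[OF conjunct2[OF *], rule_format, of "- 1" v] by simp
  show "v - w \<in> N" if "v \<in> N" "w \<in> N" for v w
    using that * m[of w] by (metis diff_conv_add_uminus)
  show "(\<And>i. i \<in> I \<Longrightarrow> h i \<in> N) \<Longrightarrow> sum h I \<in> N"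
    using * by (induction I rule: infinite_finite_induct) auto
qed

lemma submod_zero [simp]: "submod X {0}"
  by (simp add: submod_def)

lemma submod_kspan:
  fixes N :: "('x, 'k::field) fvec set"
  assumes "submod X N" "B \<subseteq> N" shows "K.span B \<subseteq> N"
  using assms by (intro K.span_minimal) (auto simp: K.subspace_def kscale_def submodD)

lemma submod_image:
  assumes "semilinear UNIV f"
  shows "submod X (f ` free_vecs X b)"
proof -
  have "f v + f w \<in> f ` free_vecs X b" if "v \<in> free_vecs X b" "w \<in> free_vecs X b" for v w
    using that by (intro image_eqI[of _ _ "v + w"]) (auto simp: slinD[OF assms])
  moreover have "vscale p (f v) \<in> f ` free_vecs X b" if "p \<in> polys X" "v \<in> free_vecs X b" for p v
    using that by (intro image_eqI[of _ _ "vscale p v"]) (auto simp: slinD[OF assms])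
  moreover have "0 \<in> f ` free_vecs X b"
    by (intro image_eqI[of _ _ 0]) (auto simp: slinD[OF assms])
  ultimately show ?thesis by (auto simp: submod_def)
qed

lemma image_subset_submod:
  fixes f :: "('x, 'k::comm_ring_1) fvec \<Rightarrow> ('x, 'k) fvec"
  assumes "semilinear UNIV f" "submod X N" "\<And>e. e \<in> basis_index b \<Longrightarrow> f (basis_vec e) \<in> N"
  shows "f ` free_vecs X b \<subseteq> N"
proof safe
  fix v :: "('x, 'k) fvec" assume "v \<in> free_vecs X b"
  then show "f v \<in> N"
  proof (induction rule: free_vecs_induct)
    case (basis_vec e p)
    then show ?case using assms(3) submodD(3)[OF assms(2)] linD[OF assms(1), of p "basis_vec e"] by simp
  qed (auto simp: slinD[OF assms(1)] submodD[OF assms(2)])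
qed

definition graded :: "('x, 'k::comm_ring_1) fvec set \<Rightarrow> bool" where
  "graded N \<longleftrightarrow> (\<forall>v\<in>N. \<forall>d. vproj d v \<in> N)"

text \<open>Expresses that \<open>N\<close> is extended from the subring in the variables of
  \<open>A\<close>. The condition passes to kernels of matrices over \<open>A\<close>, which keeps a
  whole resolution over that subring.\<close>

definition gen_over :: "'x set \<Rightarrow> 'x set \<Rightarrow> (nat \<Rightarrow> nat) \<Rightarrow> ('x, 'k::comm_ring_1) fvec set \<Rightarrow> bool" where
  "gen_over X A b N \<longleftrightarrow> N \<subseteq> finite_sums {vscale p w | p w. p \<in> polys X \<and> w \<in> N \<inter> free_vecs A b}"

text \<open>A basis of \<open>span G\<close> is extended by vectors of \<open>N\<close>; these are
  finitely many, being independent inside \<open>span T\<close>. The last clause is their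
  independence modulo \<open>span G\<close>.\<close>

lemma (in vector_space) relative_basis:
  assumes "finite T" "N \<subseteq> span T"
  shows "\<exists>(n::nat) f. (\<forall>k<n. f k \<in> N) \<and> N \<subseteq> span (G \<union> f ` {..<n}) \<and>
     (\<forall>c. (\<Sum>k<n. scale (c k) (f k)) \<in> span G \<longrightarrow> (\<forall>k<n. c k = 0))"
proof -
  obtain A where A: "A \<subseteq> G" "independent A" "G \<subseteq> span A"
    using maximal_independent_subset by blast
  obtain B' where B': "A \<subseteq> B'" "B' \<subseteq> A \<union> N" "independent B'" "A \<union> N \<subseteq> span B'"
    using maximal_independent_subset_extend[of A "A \<union> N"] A(2) by blast
  define B where "B = B' - A"
  have "independent B" using B'(3) by (rule independent_mono) (auto simp: B_def)
  moreover have "B \<subseteq> span T" using B'(2) assms(2) by (auto simp: B_def)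
  ultimately have "finite B" using independent_span_bound[OF assms(1)] by blast
  then obtain f where f: "bij_betw f {..<card B} B"
    using ex_bij_betw_nat_finite by (metis atLeast0LessThan)
  have fB: "f ` {..<card B} = B" using f by (simp add: bij_betw_def)
  have "B' \<subseteq> G \<union> B" using A by (auto simp: B_def)
  then have cover: "N \<subseteq> span (G \<union> f ` {..<card B})" unfolding fB using B'(4) span_mono by blast
  have indep: "c k = 0" if c: "(\<Sum>k<card B. scale (c k) (f k)) \<in> span G" and k: "k < card B" for c k
  proof -
    have "span G \<subseteq> span A" using A(3) span_minimal subspace_span by blast
    with c obtain t r where t: "finite t" "t \<subseteq> A"
      "(\<Sum>k<card B. scale (c k) (f k)) = (\<Sum>a\<in>t. scale (r a) a)"
      by (auto simp: span_explicit[of A])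
    define g where "g = inv_into {..<card B} f"
    have g: "g (f k) = k" if "k < card B" for k
      using that f by (simp add: g_def bij_betw_inv_into_left)
    \<comment> \<open>Bringing both expressions for a vector of \<open>span G\<close> to one side
      gives a relation in the independent set \<open>B'\<close>. Since \<open>t\<close> is contained
      in \<open>A\<close>, it is disjoint from \<open>B\<close>, and the two cases do not
      collide.\<close>
    define u where "u x = (if x \<in> B then c (g x) else - r x)" for x
    have "(\<Sum>x\<in>B \<union> t. scale (u x) x) = (\<Sum>x\<in>B. scale (u x) x) + (\<Sum>x\<in>t. scale (u x) x)"
      using t \<open>finite B\<close> by (intro sum.union_disjoint) (auto simp: B_def)
    also have "(\<Sum>x\<in>B. scale (u x) x) = (\<Sum>k<card B. scale (u (f k)) (f k))"
      by (rule sum.reindex_bij_betw[OF f, symmetric])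
    also have "\<dots> = (\<Sum>k<card B. scale (c k) (f k))"
      using f by (intro sum.cong) (auto simp: u_def g dest: bij_betwE)
    also have "(\<Sum>x\<in>t. scale (u x) x) = - (\<Sum>a\<in>t. scale (r a) a)"
      using t(2) by (auto simp: u_def B_def sum_negf[symmetric] intro!: sum.cong)
    finally have "(\<Sum>x\<in>B \<union> t. scale (u x) x) = 0" using t(3) by simp
    moreover have "f k \<in> B" using k f bij_betwE by blast
    ultimately have "u (f k) = 0"
      using independentD[OF B'(3), of "B \<union> t" u "f k"] t(1,2) B'(1) \<open>finite B\<close> by (auto simp: B_def)
    then show "c k = 0" using \<open>f k \<in> B\<close> k by (simp add: u_def g)
  qed
  show ?thesis
  proof (intro exI[of _ "card B"] exI[of _ f] conjI allI impI)
    show "f k \<in> N" if "k < card B" for k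
      using that fB B'(2) by (auto simp: B_def)
  qed (use cover indep in auto)
qed

lemma finite_basis_index_le: "finite {e \<in> basis_index b. fst e \<le> d}"
proof -
  have "{e \<in> basis_index b. fst e \<le> d} \<subseteq> (SIGMA j:{..d}. {..<b j})" by (auto simp: basis_index_def)
  then show ?thesis by (rule finite_subset) auto
qed

text \<open>Even if \<open>b\<close> has infinite support, degree \<open>d\<close> involves finitely
  many basis elements and finitely many monomials.\<close>

lemma free_vecs_hom_span:
  fixes b :: "nat \<Rightarrow> nat"
  assumes "finite X"
  shows "\<exists>T :: ('x, 'k::field) fvec set. finite T \<and> {w \<in> free_vecs X b. vhom d w} \<subseteq> K.span T"
proof -
  define M where "M = {u :: 'x \<Rightarrow>\<^sub>0 nat. keys u \<subseteq> X \<and> monomial_degree u \<le> d}"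
  define E where "E = {e \<in> basis_index b. fst e \<le> d}"
  define T :: "('x, 'k) fvec set" where "T = (\<lambda>(e, u). single e (single u 1)) ` (E \<times> M)"
  have "finite T" unfolding T_def E_def M_def
    using finite_basis_index_le finite_monomials[OF assms] by (intro finite_imageI finite_cartesian_product)
  moreover have "w \<in> K.span T" if w: "w \<in> free_vecs X b" "vhom d w" for w
  proof -
    have *: "single e (single u (lookup (lookup w e) u)) \<in> K.span T"
      if "e \<in> keys w" "u \<in> keys (lookup w e)" for e u
    proof -
      have "fst e + monomial_degree u = d" using w(2) that(2) unfolding vhom_def in_keys_iff by blast
      moreover have "e \<in> basis_index b" "keys u \<subseteq> X" using w(1) that unfolding free_vecs_def polys_def by blast+
      ultimately have "single e (single u 1) \<in> T"
        by (auto simp: T_def E_def M_def intro!: image_eqI[of _ _ "(e, u)"])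
      then have "kscale (lookup (lookup w e) u) (single e (single u 1)) \<in> K.span T"
        by (intro K.span_scale K.span_base)
      then show ?thesis by (simp add: kscale_def mult_single)
    qed
    have "w = (\<Sum>e\<in>keys w. single e (lookup w e))" by (rule poly_mapping_sum_single)
    also have "\<dots> = (\<Sum>e\<in>keys w. single e (\<Sum>u\<in>keys (lookup w e). single u (lookup (lookup w e) u)))"
      by (intro sum.cong refl arg_cong[where f = "single _"] poly_mapping_sum_single)
    also have "\<dots> = (\<Sum>e\<in>keys w. \<Sum>u\<in>keys (lookup w e). single e (single u (lookup (lookup w e) u)))"
      by (intro sum.cong refl additive_sum(2)) (simp add: single_add)
    also have "\<dots> \<in> K.span T" by (intro K.span_sum *)
    finally show ?thesis .
  qed
  ultimately show ?thesis by blast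
qed

text \<open>A graded Nakayama argument. The new generators of degree \<open>d\<close> form a basis
  of the degree \<open>d\<close> elements over \<open>A\<close> modulo those coming from lower
  degrees. They generate by induction on the degree, and their independence excludes relations with
  a nonzero constant entry.\<close>

lemma minimal_cover:
  fixes N :: "('x, 'k::field) fvec set"
  assumes "finite X" "A \<subseteq> X" and N: "submod X N" "N \<subseteq> free_vecs X b" "graded N" "gen_over X A b N"
  shows "\<exists>b' f. semilinear UNIV f \<and> (\<forall>e. f (basis_vec e) \<in> free_vecs A b \<and> vhom (fst e) (f (basis_vec e))) \<and>
    f ` free_vecs X b' = N \<and> (\<forall>v\<in>free_vecs X b'. f v = 0 \<longrightarrow> (\<forall>e. const_coeff (lookup v e) = 0))"
proof -
  define N0 where "N0 d = {w \<in> N \<inter> free_vecs A b. vhom d w}" for d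
  \<comment> \<open>These elements span what lower degrees contribute to degree \<open>d\<close>;
    \<open>u \<noteq> 0\<close> ensures \<open>d' < d\<close>.\<close>
  define G where "G d = {vscale (single u 1) w | u w d'. keys u \<subseteq> A \<and> u \<noteq> 0 \<and> w \<in> N0 d' \<and>
    monomial_degree u + d' = d}" for d
  have "\<forall>d. \<exists>(n::nat) h. (\<forall>k<n. h k \<in> N0 d) \<and> N0 d \<subseteq> K.span (G d \<union> h ` {..<n}) \<and>
     (\<forall>c. (\<Sum>k<n. kscale (c k) (h k)) \<in> K.span (G d) \<longrightarrow> (\<forall>k<n. c k = 0))"
  proof
    fix d
    obtain T :: "('x, 'k) fvec set" where "finite T" "{w \<in> free_vecs A b. vhom d w} \<subseteq> K.span T"
      using free_vecs_hom_span[OF finite_subset[OF assms(2,1)]] by blast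
    then show "\<exists>(n::nat) h. (\<forall>k<n. h k \<in> N0 d) \<and> N0 d \<subseteq> K.span (G d \<union> h ` {..<n}) \<and>
     (\<forall>c. (\<Sum>k<n. kscale (c k) (h k)) \<in> K.span (G d) \<longrightarrow> (\<forall>k<n. c k = 0))"
      by (intro K.relative_basis[of T]) (auto simp: N0_def)
  qed
  then obtain b' :: "nat \<Rightarrow> nat" and h :: "nat \<Rightarrow> nat \<Rightarrow> ('x, 'k) fvec" where bh: "\<forall>d. (\<forall>k<b' d. h d k \<in> N0 d) \<and>
      N0 d \<subseteq> K.span (G d \<union> h d ` {..<b' d}) \<and>
      (\<forall>c. (\<Sum>k<b' d. kscale (c k) (h d k)) \<in> K.span (G d) \<longrightarrow> (\<forall>k<b' d. c k = 0))"
    unfolding choice_iff by (elim exE) (rule that)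
  have h: "\<And>d k. k < b' d \<Longrightarrow> h d k \<in> N0 d"
    and span: "\<And>d. N0 d \<subseteq> K.span (G d \<union> h d ` {..<b' d})"
    and indep: "\<And>d c k. (\<Sum>k<b' d. kscale (c k) (h d k)) \<in> K.span (G d) \<Longrightarrow> k < b' d \<Longrightarrow> c k = 0"
    using bh by simp_all
  \<comment> \<open>The default \<open>0\<close> is homogeneous of every degree, so
    \<open>g e\<close> has degree \<open>fst e\<close> for all \<open>e\<close>, as the conclusion
    demands.\<close>
  define g where "g e = (if e \<in> basis_index b' then h (fst e) (snd e) else 0)" for e
  define f where "f = semilinear_ext UNIV g"
  have f: "semilinear UNIV f" "\<And>e. f (basis_vec e) = g e" by (auto simp: f_def)
  have g: "g e \<in> N0 (fst e)" if "e \<in> basis_index b'" for e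
    using that h by (auto simp: g_def basis_index_def)
  have gA: "g e \<in> free_vecs A b" "vhom (fst e) (g e)" for e
    using g[of e] by (cases "e \<in> basis_index b'"; auto simp: N0_def g_def)+
  define Im where "Im = f ` free_vecs X b'"
  have Im: "submod X Im" unfolding Im_def by (rule submod_image[OF f(1)])
  have "Im \<subseteq> N" unfolding Im_def
    by (rule image_subset_submod[OF f(1) N(1)]) (use g in \<open>auto simp: f N0_def\<close>)
  have "N0 d \<subseteq> Im" for d
  proof (induction d rule: less_induct)
    case (less d)
    have "x \<in> Im" if "x \<in> G d" for x
    proof -
      obtain u w d' where x: "x = vscale (single u 1) w" "keys u \<subseteq> A" "u \<noteq> 0" "w \<in> N0 d'"
        "monomial_degree u + d' = d"
        using \<open>x \<in> G d\<close> by (auto simp: G_def)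
      then have "d' < d" using monomial_degree_eq_0[of u] by simp
      then have "w \<in> Im" using x(4) by (rule subsetD[OF less])
      moreover have "single u 1 \<in> polys X" using x(2) assms(2) by (intro polys_single) auto
      ultimately show ?thesis unfolding x(1) by (intro submodD(3)[OF Im])
    qed
    moreover have "h d k \<in> Im" if "k < b' d" for k
    proof -
      have e: "(d, k) \<in> basis_index b'" using that by (simp add: basis_index_def)
      then have "h d k = f (basis_vec (d, k))" by (simp add: f g_def)
      then show ?thesis using e by (auto simp: Im_def)
    qed
    ultimately have "K.span (G d \<union> h d ` {..<b' d}) \<subseteq> Im"
      by (intro submod_kspan[OF Im]) auto
    then show ?case using span[of d] by (rule order.trans[rotated])
  qed
  have "w \<in> Im" if w: "w \<in> N \<inter> free_vecs A b" for w
  proof -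
    obtain D where D: "(\<Sum>d\<in>D. vproj d w) = w" using vproj_expansion[of w] by blast
    have "vproj d w \<in> N0 d" for d
      using w N(3) vproj_free_vecs[of w A b] by (simp add: N0_def graded_def)
    then have "(\<Sum>d\<in>D. vproj d w) \<in> Im"
      using \<open>\<And>d. N0 d \<subseteq> Im\<close> by (intro submodD(6)[OF Im]) blast
    then show ?thesis by (simp add: D)
  qed
  then have "finite_sums {vscale p w | p w. p \<in> polys X \<and> w \<in> N \<inter> free_vecs A b} \<subseteq> Im"
    by (intro finite_sums_subset) (use submodD[OF Im] in auto)
  with \<open>Im \<subseteq> N\<close> N(4) have "Im = N" by (auto simp: gen_over_def)
  moreover have "const_coeff (lookup v e) = 0" if v: "v \<in> free_vecs X b'" "f v = 0" for v e
  proof (cases "e \<in> basis_index b'")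
    case True
    define d where "d = fst e"
    \<comment> \<open>Passing to the coordinate at \<open>0\<close> and to the degree of
      \<open>e\<close> keeps \<open>v\<close> a relation, now homogeneous and over \<open>A\<close>,
      and does not change the constant term at \<open>e\<close>.\<close>
    define v1 where "v1 = vproj d (vslice A 0 v)"
    have "vslice A 0 v \<in> free_vecs A b'"
      using vslice_free_vecs[OF v(1), of A 0] free_vecs_mono[of "X \<inter> A" A] by blast
    then have v1: "v1 \<in> free_vecs A b'" by (simp add: v1_def vproj_free_vecs)
    have "\<And>e e'. lookup (f (basis_vec e)) e' \<in> polys A" using gA(1) by (auto simp: f free_vecs_def)
    then have "f (vslice A 0 v) = 0" using lin_vslice[OF f(1), of A 0 v] v(2) by simp
    then have fv1: "f v1 = 0"
      using semilinear_vproj[OF f(1), of d "vslice A 0 v"] gA(2) by (simp add: f v1_def)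
    have deg: "fst e + monomial_degree u = d" if "u \<in> keys (lookup v1 e)" for e u
      using that by (auto simp: v1_def in_keys_iff lookup_vproj when_def split: if_splits)
    \<comment> \<open>Entries at basis elements of another degree consist of nonconstant monomials
      and contribute to the span of \<open>G d\<close>. Entries at basis elements of degree
      \<open>d\<close> are constants, which gives \<open>top\<close>.\<close>
    have low: "vscale (lookup v1 e) (g e) \<in> K.span (G d)" if "fst e \<noteq> d" for e
    proof -
      have "vscale (single u (lookup (lookup v1 e) u)) (g e) \<in> K.span (G d)" if u: "u \<in> keys (lookup v1 e)" for u
      proof -
        have "e \<in> keys v1" using u by (auto simp: in_keys_iff)
        then have "e \<in> basis_index b'" "keys u \<subseteq> A" using v1 u unfolding free_vecs_def polys_def by blast+
        moreover have "fst e + monomial_degree u = d" by (rule deg[OF u])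
        moreover from this have "u \<noteq> 0" using \<open>fst e \<noteq> d\<close> monomial_degree_eq_0[of u] by auto
        ultimately have "vscale (single u 1) (g e) \<in> G d"
          using g[of e] unfolding G_def mem_Collect_eq
          by (intro exI[of _ u] exI[of _ "g e"] exI[of _ "fst e"]) (simp add: add.commute)
        then have "kscale (lookup (lookup v1 e) u) (vscale (single u 1) (g e)) \<in> K.span (G d)"
          by (intro K.span_scale K.span_base)
        then show ?thesis by (simp add: kscale_def mult_single)
      qed
      then have "(\<Sum>u\<in>keys (lookup v1 e). vscale (single u (lookup (lookup v1 e) u)) (g e)) \<in> K.span (G d)"
        by (rule K.span_sum)
      then have "vscale (\<Sum>u\<in>keys (lookup v1 e). single u (lookup (lookup v1 e) u)) (g e) \<in> K.span (G d)"
        unfolding vscale_sum_left .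
      then show ?thesis unfolding poly_mapping_sum_single[symmetric] .
    qed
    define c where "c k = const_coeff (lookup v1 (d, k))" for k
    have top: "lookup v1 e = single 0 (const_coeff (lookup v1 e))" if "fst e = d" for e
    proof (rule poly_mapping_eqI)
      fix u
      show "lookup (lookup v1 e) u = lookup (single 0 (const_coeff (lookup v1 e))) u"
        using deg[of u e] that monomial_degree_eq_0[of u]
        by (cases "u \<in> keys (lookup v1 e)") (auto simp: const_coeff_def lookup_single when_def in_keys_iff)
    qed
    have "0 = (\<Sum>e\<in>keys v1. vscale (lookup v1 e) (g e))"
      using semilinear_expand[OF f(1), of v1] fv1 by (simp add: f)
    also have "\<dots> = (\<Sum>e\<in>{e \<in> keys v1. fst e = d}. vscale (lookup v1 e) (g e))
        + (\<Sum>e\<in>{e \<in> keys v1. fst e \<noteq> d}. vscale (lookup v1 e) (g e))"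
      by (subst sum.union_disjoint[of "{e \<in> keys v1. fst e = d}" "{e \<in> keys v1. fst e \<noteq> d}", symmetric])
        (auto intro!: sum.cong)
    finally have "(\<Sum>e\<in>{e \<in> keys v1. fst e = d}. vscale (lookup v1 e) (g e))
        = - (\<Sum>e\<in>{e \<in> keys v1. fst e \<noteq> d}. vscale (lookup v1 e) (g e))"
      by (simp add: eq_neg_iff_add_eq_0)
    also have "\<dots> \<in> K.span (G d)"
      by (intro K.span_neg K.span_sum low) auto
    also have "(\<Sum>e\<in>{e \<in> keys v1. fst e = d}. vscale (lookup v1 e) (g e))
        = (\<Sum>e\<in>Pair d ` {..<b' d}. vscale (lookup v1 e) (g e))"
      using v1 by (intro sum.mono_neutral_left) (auto simp: free_vecs_def basis_index_def in_keys_iff)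
    also have "\<dots> = (\<Sum>k<b' d. vscale (lookup v1 (d, k)) (g (d, k)))"
      by (subst sum.reindex) (auto simp: inj_on_def)
    also have "\<dots> = (\<Sum>k<b' d. kscale (c k) (h d k))"
      by (intro sum.cong refl, subst top) (auto simp: g_def basis_index_def kscale_def c_def)
    finally have "(\<Sum>k<b' d. kscale (c k) (h d k)) \<in> K.span (G d)" .
    then have "c (snd e) = 0" using indep True by (auto simp: d_def basis_index_def)
    then have "const_coeff (lookup v1 e) = 0" by (simp add: c_def d_def)
    moreover have "const_coeff (lookup v1 e) = const_coeff (lookup v e)"
    proof -
      have "const_coeff (lookup v1 e) = const_coeff (slice A 0 (lookup v e))"
        by (simp add: v1_def const_coeff_def lookup_vproj d_def monomial_degree_def)
      then show ?thesis by simp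
    qed
    ultimately show ?thesis by simp
  next
    case False
    then have "e \<notin> keys v" using v(1) by (auto simp: free_vecs_def)
    then show ?thesis by (simp add: in_keys_iff)
  qed
  ultimately show ?thesis using gA f
    by (intro exI[of _ b'] exI[of _ f]) (simp add: Im_def)
qed

text \<open>By \<open>lin_vslice\<close> every coordinate of a kernel vector is again a kernel
  vector, now over \<open>A\<close>, and the expansion recovers the vector from its
  coordinates.\<close>

lemma kernel_gen_over:
  fixes f :: "('x, 'k::comm_ring_1) fvec \<Rightarrow> ('x, 'k) fvec" and b' :: "nat \<Rightarrow> nat"
  assumes "A \<subseteq> X" "semilinear UNIV f" "\<And>e. f (basis_vec e) \<in> free_vecs A b \<and> vhom (fst e) (f (basis_vec e))"
  defines "N \<equiv> {v \<in> free_vecs X b'. f v = 0}"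
  shows "submod X N" "N \<subseteq> free_vecs X b'" "graded N" "gen_over X A b' N"
proof -
  note f = slinD[OF assms(2)]
  show sub: "submod X N" "N \<subseteq> free_vecs X b'" by (auto simp: N_def submod_def f)
  show "graded N"
    using semilinear_vproj[OF assms(2), symmetric] assms(3) unfolding graded_def N_def
    by (simp add: vproj_free_vecs)
  show "gen_over X A b' N"
    unfolding gen_over_def
  proof
    fix v assume v: "v \<in> N"
    obtain U where U: "finite U" "(\<Sum>u\<in>U. vscale (single u 1) (vslice A u v)) = v" "\<forall>u\<in>U. keys u \<subseteq> X"
      using vslice_expansion[of A v X b'] v by (auto simp: N_def)
    have "\<And>e e'. lookup (f (basis_vec e)) e' \<in> polys A" using assms(3) by (auto simp: free_vecs_def)
    then have "f (vslice A u v) = 0" for u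
      using lin_vslice[OF assms(2), of A u v] v by (simp add: N_def)
    moreover have "vslice A u v \<in> free_vecs A b'" for u
      using vslice_free_vecs[of v X b' A u] v free_vecs_mono[of "X \<inter> A" A] by (auto simp: N_def)
    ultimately have "vslice A u v \<in> N \<inter> free_vecs A b'" for u
      using free_vecs_mono[OF assms(1)] by (auto simp: N_def)
    then have "(\<Sum>u\<in>U. vscale (single u 1) (vslice A u v)) \<in> finite_sums {vscale p w | p w. p \<in> polys X \<and> w \<in> N \<inter> free_vecs A b'}"
      by (intro finite_sums_sum finite_sums_incl) (use U(3) in \<open>auto intro!: exI polys_single\<close>)
    then show "v \<in> finite_sums {vscale p w | p w. p \<in> polys X \<and> w \<in> N \<inter> free_vecs A b'}" using U(2) by simp
  qed
qed

text \<open>\<open>minimal_cover\<close> is iterated on kernels. Minimality is carried as the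
  absence of constant terms in each kernel; it turns into a property of the differentials because
  the image of each is the preceding kernel.\<close>

lemma resolution_exists:
  fixes N :: "('x, 'k::field) fvec set"
  assumes "finite X" "A \<subseteq> X" and N: "submod X N" "N \<subseteq> free_vecs X c" "graded N" "gen_over X A c N"
  shows "\<exists>b f. b 0 = c \<and> f 0 ` free_vecs X (b 1) = N \<and>
    (\<forall>i. f (Suc i) ` free_vecs X (b (Suc (Suc i))) = {v \<in> free_vecs X (b (Suc i)). f i v = 0}) \<and>
    (\<forall>i. semilinear UNIV (f i) \<and> (\<forall>e. f i (basis_vec e) \<in> free_vecs A (b i) \<and> vhom (fst e) (f i (basis_vec e)))) \<and>
    (\<forall>i. \<forall>v\<in>free_vecs X (b (Suc i)). f i v = 0 \<longrightarrow> (\<forall>e. const_coeff (lookup v e) = 0))"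
proof -
  \<comment> \<open>A state consists of target ranks, source ranks and a map. \<open>Q\<close> makes
    the source of the current map the target of the next one and imposes exactness there.\<close>
  define P where "P n s = (case s of (bt, bs, f) \<Rightarrow> semilinear UNIV f \<and>
    (\<forall>e. f (basis_vec e) \<in> free_vecs A bt \<and> vhom (fst e) (f (basis_vec e))) \<and>
    (\<forall>v\<in>free_vecs X bs. f v = 0 \<longrightarrow> (\<forall>e. const_coeff (lookup v e) = 0)) \<and>
    (n = 0 \<longrightarrow> bt = c \<and> f ` free_vecs X bs = N))"
    for n :: nat and s :: "(nat \<Rightarrow> nat) \<times> (nat \<Rightarrow> nat) \<times> (('x, 'k) fvec \<Rightarrow> ('x, 'k) fvec)"
  define Q where "Q s s' = (case s of (bt, bs, f) \<Rightarrow> case s' of (bt', bs', f') \<Rightarrow>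
    bt' = bs \<and> f' ` free_vecs X bs' = {v \<in> free_vecs X bs. f v = 0})"
    for s s' :: "(nat \<Rightarrow> nat) \<times> (nat \<Rightarrow> nat) \<times> (('x, 'k) fvec \<Rightarrow> ('x, 'k) fvec)"
  have "\<exists>F. \<forall>n. P n (F n) \<and> Q (F n) (F (Suc n))"
  proof (rule dependent_nat_choice)
    obtain b' f where "semilinear UNIV f" "\<forall>e. f (basis_vec e) \<in> free_vecs A c \<and> vhom (fst e) (f (basis_vec e))"
      "f ` free_vecs X b' = N" "\<forall>v\<in>free_vecs X b'. f v = 0 \<longrightarrow> (\<forall>e. const_coeff (lookup v e) = 0)"
      using minimal_cover[OF assms] by blast
    then show "\<exists>x. P 0 x" by (intro exI[of _ "(c, b', f)"]) (simp add: P_def)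
  next
    fix s n assume "P n s"
    moreover obtain bt bs f where s: "s = (bt, bs, f)" by (cases s)
    ultimately have f: "semilinear UNIV f" "\<And>e. f (basis_vec e) \<in> free_vecs A bt \<and> vhom (fst e) (f (basis_vec e))"
      by (auto simp: P_def)
    obtain b' f' where "semilinear UNIV f'" "\<forall>e. f' (basis_vec e) \<in> free_vecs A bs \<and> vhom (fst e) (f' (basis_vec e))"
      "f' ` free_vecs X b' = {v \<in> free_vecs X bs. f v = 0}" "\<forall>v\<in>free_vecs X b'. f' v = 0 \<longrightarrow> (\<forall>e. const_coeff (lookup v e) = 0)"
      using minimal_cover[OF assms(1,2) kernel_gen_over[OF assms(2) f]] by blast
    then show "\<exists>y. P (Suc n) y \<and> Q s y"
      by (intro exI[of _ "(bs, b', f')"]) (simp add: P_def Q_def s)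
  qed
  then obtain F where F: "\<And>n. P n (F n)" "\<And>n. Q (F n) (F (Suc n))" by blast
  define b where "b n = fst (F n)" for n
  define f where "f n = snd (snd (F n))" for n
  have step: "b (Suc n) = fst (snd (F n))" for n
    using F(2)[of n] by (auto simp: Q_def b_def split: prod.splits)
  have F_eq: "F n = (b n, b (Suc n), f n)" for n
    using step[of n] by (simp add: b_def f_def prod_eq_iff)
  show ?thesis
  proof (intro exI[of _ b] exI[of _ f] conjI allI)
    show "b 0 = c" "f 0 ` free_vecs X (b 1) = N" using F(1)[of 0] by (auto simp: P_def F_eq)
    show "f (Suc i) ` free_vecs X (b (Suc (Suc i))) = {v \<in> free_vecs X (b (Suc i)). f i v = 0}" for i
      using F(2)[of i] by (simp add: Q_def F_eq)
    show "semilinear UNIV (f i)" "f i (basis_vec e) \<in> free_vecs A (b i)" "vhom (fst e) (f i (basis_vec e))" for i e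
      using F(1)[of i] by (auto simp: P_def F_eq)
    show "\<forall>v\<in>free_vecs X (b (Suc i)). f i v = 0 \<longrightarrow> (\<forall>e. const_coeff (lookup v e) = 0)" for i
      using F(1)[of i] by (simp add: P_def F_eq)
  qed
qed

section \<open>Comparison of minimal resolutions\<close>

text \<open>The submodule modulo which identities at index \<open>i\<close> are read: the presenting
  submodule at the resolved module, zero at the free modules above it. The augmentation thus becomes
  an instance of the general step.\<close>

definition base_mod :: "('x, 'k::comm_ring_1) fvec set \<Rightarrow> nat \<Rightarrow> ('x, 'k) fvec set" where
  "base_mod N i = (if i = 0 then N else {0})"

lemma base_mod_simps [simp]: "base_mod N 0 = N" "base_mod N (Suc i) = {0}"
  by (simp_all add: base_mod_def)

text \<open>A minimal resolution of a graded module \<open>free_vecs X (b 0) / N\<close>: the module itself is represented by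
  its presentation, and \<open>d 0\<close> is a lift of the augmentation to \<open>free_vecs X (b 0)\<close>. Hence the free module
  in homological degree \<open>i\<close> is \<open>free_vecs X (b (Suc i))\<close>.\<close>

locale minimal_res =
  fixes X :: "'x set" and b :: "nat \<Rightarrow> nat \<Rightarrow> nat" and N :: "('x, 'k::field) fvec set"
    and d :: "nat \<Rightarrow> ('x, 'k) fvec \<Rightarrow> ('x, 'k) fvec"
  assumes N: "submod X N" "graded N"
    and lin: "\<And>i. semilinear UNIV (d i)"
    and d_basis_vec: "\<And>i e. e \<in> basis_index (b (Suc i)) \<Longrightarrow> d i (basis_vec e) \<in> free_vecs X (b i)"
    and d_hom: "\<And>i e. vhom (fst e) (d i (basis_vec e))"
    and surj: "\<And>v. v \<in> free_vecs X (b 0) \<Longrightarrow> \<exists>w\<in>free_vecs X (b (Suc 0)). d 0 w - v \<in> N"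
    and exact: "\<And>i v. v \<in> free_vecs X (b (Suc i)) \<Longrightarrow>
      d i v \<in> base_mod N i \<longleftrightarrow> v \<in> d (Suc i) ` free_vecs X (b (Suc (Suc i)))"
    and minimal: "\<And>i v e. v \<in> free_vecs X (b (Suc (Suc i))) \<Longrightarrow> const_coeff (lookup (d (Suc i) v) e) = 0"
begin

lemma submod_base: "submod X (base_mod N i)"
  by (cases i) (auto simp: N)

lemma graded_base: "graded (base_mod N i)"
  by (cases i) (auto simp: N, auto simp: graded_def)

lemma d_free_vecs: "v \<in> free_vecs X (b (Suc i)) \<Longrightarrow> d i v \<in> free_vecs X (b i)"
  by (rule semilinear_free_vecs[OF lin d_basis_vec])

lemma d_d: "v \<in> free_vecs X (b (Suc (Suc i))) \<Longrightarrow> d i (d (Suc i) v) \<in> base_mod N i"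
  using exact[OF d_free_vecs] by blast

end

lemma slice_0_polys: "p \<in> polys X \<Longrightarrow> slice A 0 p \<in> polys X"
  using slice_polys[of p X A 0] polys_mono[of "X \<inter> A" X] by blast

lemma semilinear_submod:
  fixes f :: "('x, 'k::comm_ring_1) fvec \<Rightarrow> ('x, 'k) fvec"
  assumes "semilinear A f" "submod X N" "\<And>e. e \<in> basis_index b \<Longrightarrow> f (basis_vec e) \<in> N" "v \<in> free_vecs X b"
  shows "f v \<in> N"
  using assms(4)
proof (induction rule: free_vecs_induct)
  case (basis_vec e p)
  then have "vscale (slice A 0 p) (f (basis_vec e)) \<in> N"
    by (intro submodD(3)[OF assms(2)] assms(3) slice_0_polys)
  then show ?case by (simp only: slinD(2)[OF assms(1)])
qed (auto simp: slinD[OF assms(1)] submodD[OF assms(2)])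

text \<open>Projectivity of free modules: preimages are chosen for basis vectors and extended, which
  works for semilinear maps as well.\<close>

lemma semilinear_factor:
  fixes E d :: "('x, 'k::comm_ring_1) fvec \<Rightarrow> ('x, 'k) fvec"
  assumes "semilinear A E" "semilinear UNIV d" "\<And>e. e \<in> basis_index b \<Longrightarrow> E (basis_vec e) \<in> d ` free_vecs X b'"
  shows "\<exists>h. semilinear A h \<and> (\<forall>v\<in>free_vecs X b. h v \<in> free_vecs X b' \<and> E v = d (h v))"
proof -
  have "\<forall>e. \<exists>x. e \<in> basis_index b \<longrightarrow> x \<in> free_vecs X b' \<and> E (basis_vec e) = d x" using assms(3) by blast
  then obtain g where g: "\<And>e. e \<in> basis_index b \<Longrightarrow> g e \<in> free_vecs X b' \<and> E (basis_vec e) = d (g e)"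
    unfolding choice_iff by blast
  define h where "h = semilinear_ext A g"
  have h: "semilinear A h" "\<And>e. h (basis_vec e) = g e" by (auto simp: h_def)
  have "semilinear A (\<lambda>v. E v - d (h v))" using semilinear_diff[OF assms(1) semilinear_comp(2)[OF h(1) assms(2)]] .
  then have "E v - d (h v) \<in> {0}" if "v \<in> free_vecs X b" for v
    by (rule semilinear_submod[OF _ submod_zero _ that]) (use g h in auto)
  moreover have "h v \<in> free_vecs X b'" if "v \<in> free_vecs X b" for v
    by (rule semilinear_free_vecs[OF h(1) _ that]) (use g h in auto)
  ultimately show ?thesis using h(1) by auto
qed

text \<open>The comparison theorem for resolutions, in semilinear form. Lifts are prescribed on
  basis vectors, so linearity is demanded of the differentials alone.\<close>

lemma lift_resolution:
  fixes N N' :: "('x, 'k::field) fvec set"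
  assumes G: "minimal_res X b' N' d'" and F: "minimal_res X b N d"
    and f: "semilinear A f" "\<And>e. vhom (fst e) (f (basis_vec e))"
      "\<And>e. e \<in> basis_index (b' 0) \<Longrightarrow> f (basis_vec e) \<in> free_vecs X (b 0)" "f ` N' \<subseteq> N"
  shows "\<exists>\<psi>. \<psi> 0 = f \<and> (\<forall>i. semilinear A (\<psi> i)) \<and> (\<forall>i e. vhom (fst e) (\<psi> i (basis_vec e))) \<and>
    (\<forall>i. \<psi> i ` base_mod N' i \<subseteq> base_mod N i) \<and>
    (\<forall>i. \<forall>v\<in>free_vecs X (b' i). \<psi> i v \<in> free_vecs X (b i)) \<and>
    (\<forall>i. \<forall>v\<in>free_vecs X (b' (Suc i)). d i (\<psi> (Suc i) v) - \<psi> i (d' i v) \<in> base_mod N i)"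
proof -
  interpret F: minimal_res X b N d by fact
  interpret G: minimal_res X b' N' d' by fact
  \<comment> \<open>The clause with \<open>\<exists>x\<close> is what the next choice consumes: the
    images of basis vectors under \<open>d' i\<close> followed by \<open>g\<close> can be lifted
    through \<open>d i\<close>.\<close>
  define P where "P i g \<longleftrightarrow> semilinear A g \<and> (\<forall>e. vhom (fst e) (g (basis_vec e))) \<and>
    g ` base_mod N' i \<subseteq> base_mod N i \<and> (\<forall>v\<in>free_vecs X (b' i). g v \<in> free_vecs X (b i)) \<and>
    (\<forall>e\<in>basis_index (b' (Suc i)). \<exists>x\<in>free_vecs X (b (Suc i)). d i x - g (d' i (basis_vec e)) \<in> base_mod N i) \<and>
    (i = 0 \<longrightarrow> g = f)" for i and g :: "('x, 'k) fvec \<Rightarrow> ('x, 'k) fvec"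
  define Q where "Q i g g' \<longleftrightarrow> (\<forall>v\<in>free_vecs X (b' (Suc i)). d i (g' v) - g (d' i v) \<in> base_mod N i)"
    for i and g g' :: "('x, 'k) fvec \<Rightarrow> ('x, 'k) fvec"
  have "\<exists>\<psi>. \<forall>i. P i (\<psi> i) \<and> Q i (\<psi> i) (\<psi> (Suc i))"
  proof (rule dependent_nat_choice)
    have Ff: "f v \<in> free_vecs X (b 0)" if "v \<in> free_vecs X (b' 0)" for v
      by (rule semilinear_free_vecs[OF f(1,3) that])
    have "\<exists>x\<in>free_vecs X (b (Suc 0)). d 0 x - f (d' 0 (basis_vec e)) \<in> N" if "e \<in> basis_index (b' (Suc 0))" for e
      using F.surj[OF Ff[OF G.d_basis_vec[OF that]]] .
    then have "P 0 f" using f Ff by (simp add: P_def)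
    then show "\<exists>g. P 0 g" by blast
  next
    fix g i
    assume "P i g"
    then have g: "semilinear A g" "\<And>e. vhom (fst e) (g (basis_vec e))" "g ` base_mod N' i \<subseteq> base_mod N i"
      "\<And>v. v \<in> free_vecs X (b' i) \<Longrightarrow> g v \<in> free_vecs X (b i)"
      and ex: "\<And>e. e \<in> basis_index (b' (Suc i)) \<Longrightarrow> \<exists>x\<in>free_vecs X (b (Suc i)). d i x - g (d' i (basis_vec e)) \<in> base_mod N i"
      by (auto simp: P_def)
    have "\<exists>x. x \<in> free_vecs X (b (Suc i)) \<and> vhom (fst e) x \<and> d i x - g (d' i (basis_vec e)) \<in> base_mod N i"
      if e: "e \<in> basis_index (b' (Suc i))" for e
    proof -
      obtain x where x: "x \<in> free_vecs X (b (Suc i))" "d i x - g (d' i (basis_vec e)) \<in> base_mod N i"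
        using ex[OF e] by blast
      \<comment> \<open>The component of a preimage in the degree of \<open>e\<close> is again a
        preimage, because \<open>base_mod N i\<close> is graded. This makes the lift preserve
        degrees.\<close>
      have "vhom (fst e) (g (d' i (basis_vec e)))"
        by (intro semilinear_vhom[OF g(1,2)] G.d_hom)
      then have "d i (vproj (fst e) x) - g (d' i (basis_vec e)) = vproj (fst e) (d i x - g (d' i (basis_vec e)))"
        by (simp add: semilinear_vproj[OF F.lin F.d_hom] vhom_iff)
      also have "\<dots> \<in> base_mod N i" using F.graded_base x(2) unfolding graded_def by blast
      finally show ?thesis using x(1) vproj_free_vecs vhom_vproj by blast
    qed
    then have "\<forall>e. \<exists>x. e \<in> basis_index (b' (Suc i)) \<longrightarrow>
        x \<in> free_vecs X (b (Suc i)) \<and> vhom (fst e) x \<and> d i x - g (d' i (basis_vec e)) \<in> base_mod N i"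
      by blast
    then obtain x where x: "\<And>e. e \<in> basis_index (b' (Suc i)) \<Longrightarrow>
        x e \<in> free_vecs X (b (Suc i)) \<and> vhom (fst e) (x e) \<and> d i (x e) - g (d' i (basis_vec e)) \<in> base_mod N i"
      unfolding choice_iff by blast
    define g' where "g' = semilinear_ext A (\<lambda>e. if e \<in> basis_index (b' (Suc i)) then x e else 0)"
    have g': "semilinear A g'" "\<And>e. e \<in> basis_index (b' (Suc i)) \<Longrightarrow> g' (basis_vec e) = x e"
      by (auto simp: g'_def)
    have g'_hom: "vhom (fst e) (g' (basis_vec e))" for e
      using x by (auto simp: g'_def)
    have g'_free_vecs: "g' v \<in> free_vecs X (b (Suc i))" if "v \<in> free_vecs X (b' (Suc i))" for v
      by (rule semilinear_free_vecs[OF g'(1) _ that]) (use x g'(2) in auto)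
    have "semilinear A (\<lambda>v. d i (g' v) - g (d' i v))"
      by (rule semilinear_diff[OF semilinear_comp(2)[OF g'(1) F.lin] semilinear_comp(1)[OF g(1) G.lin]])
    then have Q: "d i (g' v) - g (d' i v) \<in> base_mod N i" if "v \<in> free_vecs X (b' (Suc i))" for v
      by (rule semilinear_submod[OF _ F.submod_base _ that]) (use x g'(2) in auto)
    have "\<exists>y\<in>free_vecs X (b (Suc (Suc i))). d (Suc i) y - g' (d' (Suc i) (basis_vec e)) \<in> base_mod N (Suc i)"
      if e: "e \<in> basis_index (b' (Suc (Suc i)))" for e
    proof -
      define z where "z = d' (Suc i) (basis_vec e)"
      have z: "z \<in> free_vecs X (b' (Suc i))" unfolding z_def by (rule G.d_basis_vec[OF e])
      \<comment> \<open>Since \<open>z\<close> is a cycle, \<open>Q\<close> makes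
        \<open>g' z\<close> a cycle, and exactness makes it a boundary.\<close>
      have "d' i z \<in> base_mod N' i" unfolding z_def by (rule G.d_d) (simp add: e)
      then have "g (d' i z) \<in> base_mod N i" using g(3) by blast
      from submodD(2)[OF F.submod_base Q[OF z] this]
      have "d i (g' z) \<in> base_mod N i" by simp
      then have "g' z \<in> d (Suc i) ` free_vecs X (b (Suc (Suc i)))"
        using F.exact[OF g'_free_vecs[OF z]] by blast
      then show ?thesis by (auto simp: z_def)
    qed
    then have "P (Suc i) g'"
      using g' g'_hom g'_free_vecs by (simp add: P_def slinD[OF g'(1)])
    moreover have "Q i g g'" using Q by (simp add: Q_def)
    ultimately show "\<exists>g'. P (Suc i) g' \<and> Q i g g'" by blast
  qed
  then obtain \<psi> where \<psi>: "\<And>i. P i (\<psi> i)" "\<And>i. Q i (\<psi> i) (\<psi> (Suc i))" by blast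
  show ?thesis
    by (intro exI[of _ \<psi>]) (use \<psi>[unfolded P_def Q_def] in blast)
qed

text \<open>A null homotopy gives \<open>D = d h + k d\<close>, where \<open>k\<close> is the map
  \<open>h\<close> of the preceding index, or zero at the start. The next \<open>h\<close> arises by
  lifting \<open>D - k d\<close>, which sends basis vectors to cycles. Modulo the irrelevant ideal,
  \<open>d h\<close> vanishes by minimality, and \<open>k d\<close> vanishes because the entries of
  \<open>d v\<close> have no constant terms and \<open>k\<close> is semilinear.\<close>

lemma (in minimal_res) null_homotopic_const_coeff:
  assumes D: "\<And>i. semilinear A (D i)" "\<And>i v. v \<in> free_vecs X (b i) \<Longrightarrow> D i v \<in> free_vecs X (b i)"
    and D0: "\<And>v. v \<in> free_vecs X (b 0) \<Longrightarrow> D 0 v = 0"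
    and comm: "\<And>i v. v \<in> free_vecs X (b (Suc i)) \<Longrightarrow> d i (D (Suc i) v) - D i (d i v) \<in> base_mod N i"
    and v: "v \<in> free_vecs X (b (Suc i))"
  shows "const_coeff (lookup (D (Suc i) v) e) = 0"
proof -
  have "\<exists>h k. semilinear A h \<and> semilinear A k \<and> (\<forall>v\<in>free_vecs X (b (Suc i)). h v \<in> free_vecs X (b (Suc (Suc i)))) \<and>
    (\<forall>v\<in>free_vecs X (b (Suc i)). D (Suc i) v = d (Suc i) (h v) + k (d i v)) \<and>
    (i = 0 \<longrightarrow> k = (\<lambda>_. 0))" for i
  proof (induction i)
    case 0
    have "D (Suc 0) (basis_vec e) \<in> d (Suc 0) ` free_vecs X (b (Suc (Suc 0)))" if "e \<in> basis_index (b (Suc 0))" for e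
    proof -
      have "D (Suc 0) (basis_vec e) \<in> free_vecs X (b (Suc 0))" using that by (intro D) simp
      moreover have "d 0 (D (Suc 0) (basis_vec e)) \<in> base_mod N 0"
        using comm[of "basis_vec e" 0] D0[OF d_basis_vec] that by simp
      ultimately show ?thesis using exact by blast
    qed
    then obtain h where "semilinear A h" "\<forall>v\<in>free_vecs X (b (Suc 0)). h v \<in> free_vecs X (b (Suc (Suc 0))) \<and>
        D (Suc 0) v = d (Suc 0) (h v)"
      using semilinear_factor[OF D(1) lin] by blast
    then show ?case by (intro exI[of _ h] exI[of _ "\<lambda>_. 0"]) simp
  next
    case (Suc i)
    then obtain h k where hk: "semilinear A h" "semilinear A k"
      and hk_all: "\<forall>v\<in>free_vecs X (b (Suc i)). h v \<in> free_vecs X (b (Suc (Suc i)))"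
        "\<forall>v\<in>free_vecs X (b (Suc i)). D (Suc i) v = d (Suc i) (h v) + k (d i v)"
      and k0: "i = 0 \<longrightarrow> k = (\<lambda>_. 0)"
      by (elim exE conjE) (rule that)
    define E where "E v = D (Suc (Suc i)) v - h (d (Suc i) v)" for v
    have E: "semilinear A E" unfolding E_def by (rule semilinear_diff[OF D(1) semilinear_comp(1)[OF hk(1) lin]])
    have "E (basis_vec e) \<in> d (Suc (Suc i)) ` free_vecs X (b (Suc (Suc (Suc i))))"
      if e: "e \<in> basis_index (b (Suc (Suc i)))" for e
    proof -
      have be: "basis_vec e \<in> free_vecs X (b (Suc (Suc i)))" using e by simp
      define z where "z = d (Suc i) (basis_vec e)"
      have z: "z \<in> free_vecs X (b (Suc i))" unfolding z_def by (rule d_free_vecs[OF be])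
      have EF: "E (basis_vec e) \<in> free_vecs X (b (Suc (Suc i)))"
        unfolding E_def z_def[symmetric] using D(2)[OF be] bspec[OF hk_all(1) z] by simp
      have "d i z \<in> base_mod N i" unfolding z_def by (rule d_d[OF be])
      \<comment> \<open>For \<open>i = 0\<close> the vector \<open>d 0 z\<close> lies in
        \<open>N\<close> without having to be \<open>0\<close>, and \<open>k\<close> is the zero
        map; for larger \<open>i\<close> the vector itself is \<open>0\<close>.\<close>
      then have "k (d i z) = 0"
        using k0 by (cases i) (auto simp: slinD[OF hk(2)])
      then have "D (Suc i) z = d (Suc i) (h z)" using bspec[OF hk_all(2) z] by simp
      moreover have "d (Suc i) (D (Suc (Suc i)) (basis_vec e)) = D (Suc i) z"
        using comm[OF be] by (simp add: z_def)
      ultimately have "d (Suc i) (E (basis_vec e)) \<in> base_mod N (Suc i)"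
        by (simp add: E_def slinD[OF lin] z_def)
      then show ?thesis using exact[OF EF] by blast
    qed
    then obtain h' where h': "semilinear A h'" "\<forall>v\<in>free_vecs X (b (Suc (Suc i))). h' v \<in> free_vecs X (b (Suc (Suc (Suc i)))) \<and>
        E v = d (Suc (Suc i)) (h' v)"
      using semilinear_factor[OF E lin] by blast
    then have "D (Suc (Suc i)) v = d (Suc (Suc i)) (h' v) + h (d (Suc i) v)"
      if "v \<in> free_vecs X (b (Suc (Suc i)))" for v
      using that by (auto simp: E_def diff_eq_eq)
    then show ?case using h' hk(1) by (intro exI[of _ h'] exI[of _ h]) simp
  qed
  from this[of i] obtain h k where "semilinear A k"
    and *: "\<forall>v\<in>free_vecs X (b (Suc i)). h v \<in> free_vecs X (b (Suc (Suc i)))"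
      "\<forall>v\<in>free_vecs X (b (Suc i)). D (Suc i) v = d (Suc i) (h v) + k (d i v)"
      "i = 0 \<longrightarrow> k = (\<lambda>_. 0)"
    by (elim exE conjE) (rule that)
  then have hk: "semilinear A k" "h v \<in> free_vecs X (b (Suc (Suc i)))"
    "D (Suc i) v = d (Suc i) (h v) + k (d i v)" "i = 0 \<longrightarrow> k = (\<lambda>_. 0)"
    using v by auto
  have "const_coeff (lookup (k (d i v)) e) = 0"
  proof (cases i)
    case (Suc j)
    have "const_coeff (lookup (d i v) e) = 0" for e
      using minimal[of v j] v by (simp add: Suc)
    then show ?thesis
      by (subst semilinear_expand[OF hk(1)]) (simp add: lookup_sum const_coeff_sum)
  qed (use hk(4) in simp)
  moreover have "const_coeff (lookup (d (Suc i) (h v)) e) = 0"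
    by (rule minimal[OF hk(2)])
  ultimately show ?thesis by (simp add: hk(3) lookup_add)
qed

section \<open>Rank comparison over the residue field\<close>

text \<open>The columns of \<open>a\<close> are independent because the rows of \<open>g\<close>
  separate them, and they lie in the span of \<open>m\<close> vectors. Columns are realised as
  constant vectors with basis indices \<open>(0, i)\<close>, so that \<open>K\<close> can serve as
  the vector space.\<close>

lemma left_inverse_dim:
  fixes a g :: "nat \<Rightarrow> nat \<Rightarrow> 'k::field"
  assumes "\<And>k l. k < n \<Longrightarrow> l < n \<Longrightarrow> (\<Sum>i<m. g l i * a i k) = (if l = k then 1 else 0)"
  shows "n \<le> m"
proof -
  define v :: "nat \<Rightarrow> (nat, 'k) fvec" where "v k = (\<Sum>i<m. kscale (a i k) (basis_vec (0, i)))" for k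
  define \<phi> :: "nat \<Rightarrow> (nat, 'k) fvec \<Rightarrow> 'k" where "\<phi> l w = (\<Sum>i<m. g l i * const_coeff (lookup w (0, i)))" for l w
  have coord: "const_coeff (lookup (v k) (0, i)) = a i k" if "i < m" for i k
    using that by (simp add: v_def kscale_def lookup_sum const_coeff_sum basis_vec_def lookup_single when_def const_coeff_single if_distrib cong: if_cong)
  have \<phi>: "\<phi> l (v k) = (if l = k then 1 else 0)" if "k < n" "l < n" for k l
    using assms[OF that] by (simp add: \<phi>_def coord)
  have \<phi>_add: "\<phi> l (x + y) = \<phi> l x + \<phi> l y" for l x y
    by (simp add: \<phi>_def lookup_add distrib_left sum.distrib)
  have \<phi>_scale: "\<phi> l (kscale c x) = c * \<phi> l x" for l c x
    by (simp add: \<phi>_def kscale_def const_coeff_single sum_distrib_left algebra_simps)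
  have inj: "inj_on v {..<n}"
    by (rule inj_onI) (metis \<phi> lessThan_iff one_neq_zero)
  have "K.independent (v ` {..<n})"
  proof (rule K.independent_if_scalars_zero)
    fix f x assume *: "(\<Sum>x\<in>v ` {..<n}. kscale (f x) x) = 0" and "x \<in> v ` {..<n}"
    then obtain l where l: "l < n" "x = v l" by auto
    have "0 = \<phi> l (\<Sum>k<n. kscale (f (v k)) (v k))"
      using * by (simp add: sum.reindex[OF inj] \<phi>_def)
    also have "\<dots> = (\<Sum>k<n. f (v k) * \<phi> l (v k))"
      by (simp add: additive_sum(2)[of "\<phi> l", OF \<phi>_add] \<phi>_scale)
    also have "\<dots> = (\<Sum>k<n. if k = l then f (v k) else 0)"
      using l by (intro sum.cong) (auto simp: \<phi>)
    also have "\<dots> = f x" using l by simp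
    finally show "f x = 0" by simp
  qed simp
  moreover have "v k \<in> K.span ((\<lambda>i. basis_vec (0, i)) ` {..<m})" for k
    unfolding v_def by (rule K.span_sum, rule K.span_scale, rule K.span_base) auto
  then have "v ` {..<n} \<subseteq> K.span ((\<lambda>i. basis_vec (0, i)) ` {..<m})" by auto
  ultimately have "card (v ` {..<n}) \<le> card ((\<lambda>i. basis_vec (0, i) :: (nat, 'k) fvec) ` {..<m})"
    using K.independent_span_bound by blast
  also have "\<dots> \<le> m" using card_image_le[of "{..<m}"] by simp
  finally show ?thesis by (simp add: card_image[OF inj])
qed

text \<open>The constant terms of the lifts \<gamma> and \<alpha> form matrices over the field whose
  product is the identity. As \<alpha> preserves degrees, only basis elements of degree
  \<open>j\<close> take part, and \<open>left_inverse_dim\<close> applies to that block.\<close>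

lemma betti_retract_le:
  fixes N N' :: "('x, 'k::field) fvec set"
  assumes G: "minimal_res X b' N' d'" and F: "minimal_res X b N d" and b0: "b' 0 = b 0"
    and sub: "N' \<subseteq> N" and retr: "vslice A 0 ` N \<subseteq> N'"
    and rational: "\<And>i e e'. lookup (d' i (basis_vec e)) e' \<in> polys A"
  shows "b' (Suc i) j \<le> b (Suc i) j"
proof -
  interpret F: minimal_res X b N d by fact
  interpret G: minimal_res X b' N' d' by fact
  obtain \<alpha> where \<alpha>: "\<alpha> 0 = (\<lambda>v. v)" "\<And>i. semilinear UNIV (\<alpha> i)" "\<And>i e. vhom (fst e) (\<alpha> i (basis_vec e))"
    "\<And>i v. v \<in> free_vecs X (b' i) \<Longrightarrow> \<alpha> i v \<in> free_vecs X (b i)"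
    "\<And>i v. v \<in> free_vecs X (b' (Suc i)) \<Longrightarrow> d i (\<alpha> (Suc i) v) - \<alpha> i (d' i v) \<in> base_mod N i"
  proof -
    obtain \<psi> where \<psi>: "\<psi> 0 = (\<lambda>v. v) \<and> (\<forall>i. semilinear UNIV (\<psi> i)) \<and> (\<forall>i e. vhom (fst e) (\<psi> i (basis_vec e))) \<and>
      (\<forall>i. \<psi> i ` base_mod N' i \<subseteq> base_mod N i) \<and>
      (\<forall>i. \<forall>v\<in>free_vecs X (b' i). \<psi> i v \<in> free_vecs X (b i)) \<and>
      (\<forall>i. \<forall>v\<in>free_vecs X (b' (Suc i)). d i (\<psi> (Suc i) v) - \<psi> i (d' i v) \<in> base_mod N i)"
      using lift_resolution[OF G F, of UNIV "\<lambda>v. v"] sub by (simp add: b0) blast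
    then show thesis by (intro that[of \<psi>]) blast+
  qed
  have sl: "semilinear A (vslice A 0)" by simp
  have vsb: "vslice A 0 (basis_vec e) = basis_vec e" for e
    by (rule vslice_0_id) (simp add: basis_vec_def lookup_single when_def)
  obtain \<gamma> where \<gamma>: "\<gamma> 0 = vslice A 0" "\<And>i. semilinear A (\<gamma> i)"
    "\<And>i. \<gamma> i ` base_mod N i \<subseteq> base_mod N' i"
    "\<And>i v. v \<in> free_vecs X (b i) \<Longrightarrow> \<gamma> i v \<in> free_vecs X (b' i)"
    "\<And>i v. v \<in> free_vecs X (b (Suc i)) \<Longrightarrow> d' i (\<gamma> (Suc i) v) - \<gamma> i (d i v) \<in> base_mod N' i"
  proof -
    obtain \<psi> where \<psi>: "\<psi> 0 = vslice A 0 \<and> (\<forall>i. semilinear A (\<psi> i)) \<and> (\<forall>i e. vhom (fst e) (\<psi> i (basis_vec e))) \<and>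
      (\<forall>i. \<psi> i ` base_mod N i \<subseteq> base_mod N' i) \<and>
      (\<forall>i. \<forall>v\<in>free_vecs X (b i). \<psi> i v \<in> free_vecs X (b' i)) \<and>
      (\<forall>i. \<forall>v\<in>free_vecs X (b (Suc i)). d' i (\<psi> (Suc i) v) - \<psi> i (d i v) \<in> base_mod N' i)"
      using lift_resolution[OF F G sl] retr by (simp add: b0 vsb) blast
    then show thesis by (intro that[of \<psi>]) blast+
  qed
  define D where "D i v = \<gamma> i (\<alpha> i v) - vslice A 0 v" for i v
  have vs_free_vecs: "vslice A 0 v \<in> free_vecs X c" if "v \<in> free_vecs X c" for v c
    using vslice_free_vecs[OF that, of A 0] free_vecs_mono[of "X \<inter> A" X] by blast
  have cstD: "const_coeff (lookup (D (Suc i) v) e) = 0" if "v \<in> free_vecs X (b' (Suc i))" for v e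
  proof (rule G.null_homotopic_const_coeff[OF _ _ _ _ that])
    show "semilinear A (D i)" for i unfolding D_def by (rule semilinear_diff[OF semilinear_comp(1)[OF \<gamma>(2) \<alpha>(2)] sl])
    show "D i v \<in> free_vecs X (b' i)" if "v \<in> free_vecs X (b' i)" for i v
      unfolding D_def using \<gamma>(4)[OF \<alpha>(4)[OF that]] vs_free_vecs[OF that] by simp
    show "D 0 v = 0" for v by (simp add: D_def \<alpha> \<gamma>)
    show "d' i (D (Suc i) v) - D i (d' i v) \<in> base_mod N' i" if v: "v \<in> free_vecs X (b' (Suc i))" for i v
    proof -
      have "\<gamma> i (d i (\<alpha> (Suc i) v) - \<alpha> i (d' i v)) \<in> base_mod N' i"
        using \<gamma>(3)[of i] \<alpha>(5)[OF v] by blast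
      \<comment> \<open>The congruence for \<gamma> at the vector \<open>\<alpha> (Suc i) v\<close>
        is added to the image under \<gamma> of the congruence for \<alpha>. The substitution
        commutes with \<open>d'\<close> by \<open>rational\<close>.\<close>
      from submodD(2)[OF G.submod_base \<gamma>(5)[OF \<alpha>(4)[OF v]] this]
      show ?thesis
        by (simp add: D_def slinD[OF \<gamma>(2)] slinD[OF G.lin] lin_vslice[OF G.lin rational])
    qed
  qed
  define a where "a k' k = const_coeff (lookup (\<alpha> (Suc i) (basis_vec (j, k))) (j, k'))" for k' k
  define g where "g l k' = const_coeff (lookup (\<gamma> (Suc i) (basis_vec (j, k'))) (j, l))" for l k'
  show ?thesis
  proof (rule left_inverse_dim[where g = g and a = a])
    fix k l assume kl: "k < b' (Suc i) j" "l < b' (Suc i) j"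
    define w where "w = \<alpha> (Suc i) (basis_vec (j, k))"
    have w: "w \<in> free_vecs X (b (Suc i))" unfolding w_def using kl by (intro \<alpha>) (simp add: basis_index_def)
    have hom: "vhom j w" using \<alpha>(3)[of "(j, k)" "Suc i"] by (simp add: w_def)
    \<comment> \<open>A nonzero constant entry at \<open>e\<close> has degree \<open>fst e\<close>,
      so homogeneity reduces the sum to the finite block of degree \<open>j\<close>.\<close>
    have "fst e = j" if "const_coeff (lookup w e) \<noteq> 0" for e
      using hom that unfolding vhom_def const_coeff_def by (metis add_0_right monomial_degree_eq_0)
    then have "(\<Sum>e\<in>keys w. const_coeff (lookup w e) * const_coeff (lookup (\<gamma> (Suc i) (basis_vec e)) (j, l)))
        = (\<Sum>e\<in>Pair j ` {..<b (Suc i) j}. const_coeff (lookup w e) * const_coeff (lookup (\<gamma> (Suc i) (basis_vec e)) (j, l)))"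
      using w by (intro sum.mono_neutral_cong) (force simp: in_keys_iff free_vecs_def basis_index_def image_iff)+
    also have "\<dots> = (\<Sum>k'<b (Suc i) j. g l k' * a k' k)"
      by (subst sum.reindex) (auto simp: inj_on_def g_def a_def w_def mult.commute)
    finally have "(\<Sum>k'<b (Suc i) j. g l k' * a k' k) = const_coeff (lookup (\<gamma> (Suc i) w) (j, l))"
      by (subst semilinear_expand[OF \<gamma>(2)]) (simp add: lookup_sum const_coeff_sum)
    also have "\<dots> = const_coeff (lookup (vslice A 0 (basis_vec (j, k))) (j, l))"
      using cstD[of "basis_vec (j, k)" "(j, l)"] kl by (simp add: D_def w_def basis_index_def lookup_minus)
    also have "\<dots> = (if l = k then 1 else 0)"
      by (simp add: vsb) (simp add: basis_vec_def lookup_single when_def)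
    finally show "(\<Sum>k'<b (Suc i) j. g l k' * a k' k) = (if l = k then 1 else 0)" .
  qed
qed

section \<open>Resolutions of quotients of polynomial rings\<close>

lemma polynomial_ring_simps [simp]:
  "mult (polynomial_ring X) = (*)" "one (polynomial_ring X) = 1"
  "zero (polynomial_ring X) = 0" "add (polynomial_ring X) = (+)"
  by (simp_all add: polynomial_ring_def)

lemma cring_polynomial_ring: "cring (polynomial_ring X)"
proof (rule cringI)
  show "abelian_group (polynomial_ring X)"
    by (rule abelian_groupI) (auto simp: algebra_simps intro!: bexI[of _ "- x" for x])
  show "comm_monoid (polynomial_ring X)"
    by (rule comm_monoidI) (auto simp: algebra_simps)
qed (auto simp: algebra_simps)

lemma polynomial_ring_a_inv: "p \<in> polys X \<Longrightarrow> a_inv (polynomial_ring X) p = - p"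
proof -
  assume p: "p \<in> polys X"
  interpret cring "polynomial_ring X" by (rule cring_polynomial_ring)
  show ?thesis by (rule minus_equality) (use p in simp_all)
qed

context
  fixes X :: "'x set" and J :: "('x, 'k::comm_ring_1) mpoly set"
  assumes J: "ideal J (polynomial_ring X)"
begin

interpretation ideal J "polynomial_ring X" by (rule J)

lemma ideal_polys: "J \<subseteq> polys X"
  using a_subset by simp

lemma ideal_0: "0 \<in> J"
  using additive_subgroup.zero_closed[OF is_additive_subgroup] by simp

lemma ideal_add: "p \<in> J \<Longrightarrow> q \<in> J \<Longrightarrow> p + q \<in> J"
  using additive_subgroup.a_closed[OF is_additive_subgroup] by simp

lemma ideal_mult: "p \<in> polys X \<Longrightarrow> q \<in> J \<Longrightarrow> p * q \<in> J"
  using I_l_closed by simp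

lemma ideal_uminus: "p \<in> J \<Longrightarrow> - p \<in> J"
  using ideal_mult[of "- 1" p] by simp

lemma coset_image: "J +>\<^bsub>polynomial_ring X\<^esub> p = (\<lambda>q. q + p) ` J"
  by (auto simp: a_r_coset_def')

lemma coset_eq_iff: "J +>\<^bsub>polynomial_ring X\<^esub> p = J +>\<^bsub>polynomial_ring X\<^esub> q \<longleftrightarrow> p - q \<in> J"
proof
  assume "J +>\<^bsub>polynomial_ring X\<^esub> p = J +>\<^bsub>polynomial_ring X\<^esub> q"
  moreover have "p \<in> J +>\<^bsub>polynomial_ring X\<^esub> p"
    unfolding coset_image by (intro image_eqI[of _ _ 0]) (auto simp: ideal_0)
  ultimately show "p - q \<in> J" unfolding coset_image by auto
next
  assume *: "p - q \<in> J"
  have "r + p \<in> (\<lambda>r. r + q) ` J" if "r \<in> J" for r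
    using ideal_add[OF that *] by (intro image_eqI[of _ _ "r + (p - q)"]) auto
  moreover have "r + q \<in> (\<lambda>r. r + p) ` J" if "r \<in> J" for r
    using ideal_add[OF that ideal_uminus[OF *]] by (intro image_eqI[of _ _ "r + (q - p)"]) auto
  ultimately show "J +>\<^bsub>polynomial_ring X\<^esub> p = J +>\<^bsub>polynomial_ring X\<^esub> q"
    unfolding coset_image by auto
qed

lemma coset_eq_ideal_iff: "J +>\<^bsub>polynomial_ring X\<^esub> p = J \<longleftrightarrow> p \<in> J"
  using coset_eq_iff[of p 0] by (simp add: coset_image)

lemma quotient_carrier: "carrier (quotient_module (polynomial_ring X) J)
    = (\<lambda>p. J +>\<^bsub>polynomial_ring X\<^esub> p) ` polys X"
  by (auto simp: quotient_module_def FactRing_def A_RCOSETS_def')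

lemma quotient_zero: "zero (quotient_module (polynomial_ring X) J) = J"
  by (simp add: quotient_module_def FactRing_def)

lemma quotient_add: "p \<in> polys X \<Longrightarrow> q \<in> polys X \<Longrightarrow>
    (J +>\<^bsub>polynomial_ring X\<^esub> p) \<oplus>\<^bsub>quotient_module (polynomial_ring X) J\<^esub> (J +>\<^bsub>polynomial_ring X\<^esub> q)
      = J +>\<^bsub>polynomial_ring X\<^esub> (p + q)"
  using a_rcos_sum[of p q] by (simp add: quotient_module_def FactRing_def)

lemma quotient_smult: "p \<in> polys X \<Longrightarrow> q \<in> polys X \<Longrightarrow>
    p \<odot>\<^bsub>quotient_module (polynomial_ring X) J\<^esub> (J +>\<^bsub>polynomial_ring X\<^esub> q)
      = J +>\<^bsub>polynomial_ring X\<^esub> (p * q)"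
  using rcoset_mult_add[of p q] by (simp add: quotient_module_def FactRing_def)

lemma quotient_component: "component (quotient_module (polynomial_ring X) J) d
    = (\<lambda>p. J +>\<^bsub>polynomial_ring X\<^esub> p) ` homogeneous_part (polynomial_ring X) d"
  by (simp add: quotient_module_def)

end

section \<open>Ideals as graded submodules of the free module of rank one, generated in degree
  zero\<close>

definition rank_one :: "nat \<Rightarrow> nat" where
  "rank_one j = (if j = 0 then 1 else 0)"

lemma basis_index_rank_one: "basis_index rank_one = {(0, 0)}"
  by (auto simp: basis_index_def rank_one_def split: if_splits)

definition rank_one_embed :: "('x, 'k::comm_ring_1) mpoly set \<Rightarrow> ('x, 'k) fvec set" where
  "rank_one_embed J = single (0, 0) ` J"

lemma free_vecs_rank_one: "v \<in> free_vecs X rank_one \<longleftrightarrow> (\<exists>p\<in>polys X. v = single (0, 0) p)"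
proof
  assume v: "v \<in> free_vecs X rank_one"
  have "v = single (0, 0) (lookup v (0, 0))"
  proof (rule poly_mapping_eqI)
    fix e
    have "e = (0, 0) \<or> e \<notin> keys v" using v by (auto simp: free_vecs_def basis_index_rank_one)
    then show "lookup v e = lookup (single (0, 0) (lookup v (0, 0))) e"
      by (auto simp: lookup_single when_def in_keys_iff)
  qed
  then show "\<exists>p\<in>polys X. v = single (0, 0) p" using v unfolding free_vecs_def by blast
qed (auto simp: basis_index_rank_one)

lemma rank_one_embed_iff: "single (0, 0) p \<in> rank_one_embed J \<longleftrightarrow> p \<in> J"
  by (simp add: rank_one_embed_def inj_image_mem_iff)

lemma submod_embed:
  assumes "ideal J (polynomial_ring X)" shows "submod X (rank_one_embed J)"
proof -
  have "0 \<in> rank_one_embed J" using rank_one_embed_iff[of 0 J] ideal_0[OF assms] by simp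
  moreover have "v + w \<in> rank_one_embed J" if vw: "v \<in> rank_one_embed J" "w \<in> rank_one_embed J" for v w
  proof -
    obtain p q where "p \<in> J" "q \<in> J" "v = single (0, 0) p" "w = single (0, 0) q"
      using vw unfolding rank_one_embed_def by blast
    then show ?thesis using ideal_add[OF assms, of p q] by (simp add: rank_one_embed_iff flip: single_add)
  qed
  moreover have "vscale p v \<in> rank_one_embed J" if "p \<in> polys X" "v \<in> rank_one_embed J" for p v
    using that ideal_mult[OF assms] by (auto simp: rank_one_embed_def)
  ultimately show ?thesis by (simp add: submod_def)
qed

lemma embed_subset_free_vecs: "ideal J (polynomial_ring X) \<Longrightarrow> rank_one_embed J \<subseteq> free_vecs X rank_one"
  using ideal_polys[of J X] by (auto simp: rank_one_embed_def basis_index_rank_one)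

lemma single_homogeneous: "p \<in> homogeneous_part (polynomial_ring X) d \<Longrightarrow> vhom d (single (0, 0) p)"
  by (auto simp: homogeneous_part_def vhom_def lookup_single when_def in_keys_iff)

text \<open>A degree projection fixes or kills each homogeneous summand, and these summands lie in
  \<open>J\<close>.\<close>

lemma graded_embed:
  assumes "ideal J (polynomial_ring X)"
    "J \<subseteq> finite_sums (J \<inter> (\<Union>d. homogeneous_part (polynomial_ring X) d))"
  shows "graded (rank_one_embed J)"
  unfolding graded_def
proof (intro ballI allI)
  fix v d assume "v \<in> rank_one_embed J"
  then obtain p where p: "p \<in> J" "v = single (0, 0) p" by (auto simp: rank_one_embed_def)
  have "vproj d (single (0, 0) p) \<in> rank_one_embed J"
    if "p \<in> finite_sums (J \<inter> (\<Union>d. homogeneous_part (polynomial_ring X) d))" for p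
    using that
  proof induction
    case (add q r)
    then obtain k where "q \<in> J" "q \<in> homogeneous_part (polynomial_ring X) k" by auto
    then have "vproj d (single (0, 0) q) \<in> rank_one_embed J"
      using vproj_vhom[OF single_homogeneous, of q X k d] submodD(1)[OF submod_embed[OF assms(1)]]
      by (simp add: rank_one_embed_iff)
    then show ?case using submodD(2)[OF submod_embed[OF assms(1)] _ add(3)] by (simp add: single_add)
  qed (use submodD(1)[OF submod_embed[OF assms(1)]] in simp)
  then show "vproj d v \<in> rank_one_embed J" using p assms(2) by auto
qed

lemma gen_over_embed:
  assumes "J \<subseteq> finite_sums {p * g | p g. p \<in> polys X \<and> g \<in> J \<inter> polys A}"
  shows "gen_over X A rank_one (rank_one_embed J)"
proof -
  define D where "D = {vscale p w | p w. p \<in> polys X \<and> w \<in> rank_one_embed J \<inter> free_vecs A rank_one}"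
  have "single (0, 0) q \<in> finite_sums D" if "q \<in> finite_sums {p * g | p g. p \<in> polys X \<and> g \<in> J \<inter> polys A}" for q
    using that
  proof induction
    case (add a q)
    then obtain p g where pg: "a = p * g" "p \<in> polys X" "g \<in> J" "g \<in> polys A" by blast
    then have "vscale p (single (0, 0) g) \<in> D"
      unfolding D_def by (intro CollectI exI conjI refl) (auto simp: rank_one_embed_iff free_vecs_rank_one)
    then have "single (0, 0) a \<in> D" by (simp add: pg)
    then show ?case using add by (simp add: single_add finite_sums.add)
  qed (simp add: finite_sums.zero)
  then have "rank_one_embed J \<subseteq> finite_sums D" using assms by (auto simp: rank_one_embed_def)
  then show ?thesis unfolding gen_over_def D_def .
qed

section \<open>Translation between module records and vectors\<close>

lemma free_module_simps [simp]:
  "carrier (graded_free_module (polynomial_ring X) b) = free_vecs X b"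
  "zero (graded_free_module (polynomial_ring X) b) = 0"
  "add (graded_free_module (polynomial_ring X) b) = (+)"
  "smult (graded_free_module (polynomial_ring X) b) = vscale"
  by (simp_all add: graded_free_module_def Let_def free_vecs_def basis_index_def vscale_def fun_eq_iff)

text \<open>The bound \<open>j \<le> d\<close> compensates the truncated subtraction in
  \<open>d - j\<close>; together they amount to the degree equation in \<open>vhom\<close>.\<close>

lemma free_module_component [simp]:
  fixes X :: "'x set"
  shows "component (graded_free_module (polynomial_ring X) b) d
    = {v :: ('x, 'k::comm_ring_1) fvec. v \<in> free_vecs X b \<and> vhom d v}"
proof -
  have "(\<forall>(j, k)\<in>keys v. j \<le> d \<and> lookup v (j, k) \<in> homogeneous_part (polynomial_ring X) (d - j)) \<longleftrightarrow> vhom d v"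
    if v: "v \<in> free_vecs X b" for v :: "('x, 'k) fvec"
  proof
    assume *: "\<forall>(j, k)\<in>keys v. j \<le> d \<and> lookup v (j, k) \<in> homogeneous_part (polynomial_ring X) (d - j)"
    show "vhom d v"
      unfolding vhom_def
    proof (intro allI impI)
      fix e u assume u: "lookup (lookup v e) u \<noteq> 0"
      then have "e \<in> keys v" by (auto simp: in_keys_iff)
      from bspec[OF * this]
      have "fst e \<le> d" "lookup v e \<in> homogeneous_part (polynomial_ring X) (d - fst e)"
        by (simp_all add: case_prod_beta)
      with u show "fst e + monomial_degree u = d"
        by (auto simp: homogeneous_part_def in_keys_iff)
    qed
  next
    assume *: "vhom d v"
    show "\<forall>(j, k)\<in>keys v. j \<le> d \<and> lookup v (j, k) \<in> homogeneous_part (polynomial_ring X) (d - j)"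
    proof safe
      fix j k assume "(j, k) \<in> keys v"
      then have "lookup v (j, k) \<noteq> 0" by (simp add: in_keys_iff)
      then obtain u where "lookup (lookup v (j, k)) u \<noteq> 0"
        by (metis lookup_zero poly_mapping_eqI)
      then have "j + monomial_degree u = d" using * unfolding vhom_def by (metis fst_conv)
      then show "j \<le> d" by simp
      have "lookup v (j, k) \<in> polys X" using v by (auto simp: free_vecs_def)
      moreover have "monomial_degree w = d - j" if "w \<in> keys (lookup v (j, k))" for w
      proof -
        have "j + monomial_degree w = d" using * that unfolding vhom_def in_keys_iff by (metis fst_conv)
        then show ?thesis by simp
      qed
      ultimately show "lookup v (j, k) \<in> homogeneous_part (polynomial_ring X) (d - j)"
        by (simp add: homogeneous_part_def)
    qed
  qed
  then show ?thesis
    by (auto simp: graded_free_module_def Let_def free_vecs_def basis_index_def)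
qed

text \<open>A module homomorphism is constrained on its carrier alone, whereas
  \<open>semilinear\<close> speaks of all vectors. Extending the values on basis vectors gives a
  total linear map that agrees with it on the carrier.\<close>

lemma hom_eq_semilinear_ext:
  fixes f :: "('x, 'k::comm_ring_1) fvec \<Rightarrow> ('x, 'k) fvec"
  assumes "\<And>v w. v \<in> free_vecs X b \<Longrightarrow> w \<in> free_vecs X b \<Longrightarrow> f (v + w) = f v + f w"
    and "\<And>p v. p \<in> polys X \<Longrightarrow> v \<in> free_vecs X b \<Longrightarrow> f (vscale p v) = vscale p (f v)"
    and "v \<in> free_vecs X b"
  shows "f v = semilinear_ext UNIV (\<lambda>e. if e \<in> basis_index b then f (basis_vec e) else 0) v"
proof -
  define h where "h = semilinear_ext UNIV (\<lambda>e. if e \<in> basis_index b then f (basis_vec e) else 0)"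
  have h: "semilinear UNIV h" by (simp add: h_def)
  have "v \<in> free_vecs X b \<and> f v = h v" using assms(3)
  proof (induction rule: free_vecs_induct)
    case zero
    show ?case using assms(2)[of 0 0] by (simp add: slinD[OF h])
  next
    case (basis_vec e p)
    then have "f (vscale p (basis_vec e)) = vscale p (f (basis_vec e))" "h (vscale p (basis_vec e)) = vscale p (f (basis_vec e))"
      by (simp_all only: assms(2) free_vecs_basis_vec linD[OF h]) (simp add: h_def)
    then show ?case using basis_vec by simp
  qed (simp add: assms(1) slinD[OF h])
  then show ?thesis by (simp add: h_def)
qed

text \<open>Homogeneous representatives of the cosets \<open>\<epsilon> (basis_vec e)\<close> define
  a linear lift \<open>d0\<close> of the augmentation. Its kernel modulo \<open>J\<close> becomes
  the preimage of \<open>rank_one_embed J\<close>, and \<open>case_nat\<close> places the rank one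
  module below the ranks \<open>\<beta>\<close>.\<close>

lemma minimal_res_of_resolution:
  fixes J :: "('x, 'k::field) mpoly set"
  assumes J: "ideal J (polynomial_ring X)"
    and hom: "J \<subseteq> finite_sums (J \<inter> (\<Union>d. homogeneous_part (polynomial_ring X) d))"
    and res: "minimal_graded_free_resolution (polynomial_ring X) (quotient_module (polynomial_ring X) J) \<beta> \<epsilon> \<phi>"
  shows "\<exists>d. minimal_res X (case_nat rank_one \<beta>) (rank_one_embed J) d"
proof -
  let ?S = "polynomial_ring X :: ('x, 'k) mpoly ring"
  let ?Q = "quotient_module ?S J"
  note res' = res[unfolded minimal_graded_free_resolution_def Let_def]
  have \<epsilon>: "\<epsilon> \<in> graded_module_hom ?S (graded_free_module ?S (\<beta> 0)) ?Q"
    and \<phi>: "\<And>i. \<phi> i \<in> graded_module_hom ?S (graded_free_module ?S (\<beta> (Suc i))) (graded_free_module ?S (\<beta> i))"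
    and \<epsilon>_surj: "\<epsilon> ` free_vecs X (\<beta> 0) = (\<lambda>p. J +>\<^bsub>?S\<^esub> p) ` polys X"
    and ker0: "{v \<in> free_vecs X (\<beta> 0). \<epsilon> v = J} = \<phi> 0 ` free_vecs X (\<beta> 1)"
    and ker: "\<And>i. {v \<in> free_vecs X (\<beta> (Suc i)). \<phi> i v = 0} = \<phi> (Suc i) ` free_vecs X (\<beta> (Suc (Suc i)))"
    and min: "\<And>i v e. v \<in> free_vecs X (\<beta> (Suc i)) \<Longrightarrow> lookup (\<phi> i v) e \<in> irrelevant_ideal ?S"
    using res' by (simp_all add: a_kernel_def' quotient_zero[OF J] quotient_carrier[OF J])
  have \<phi>_hom: "\<phi> i v \<in> free_vecs X (\<beta> i)" "\<phi> i (v + w) = \<phi> i v + \<phi> i w"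
    "p \<in> polys X \<Longrightarrow> \<phi> i (vscale p v) = vscale p (\<phi> i v)" "vhom k v \<Longrightarrow> vhom k (\<phi> i v)"
    if "v \<in> free_vecs X (\<beta> (Suc i))" "w \<in> free_vecs X (\<beta> (Suc i))" for i v w p k
    using \<phi>[of i] that by (auto simp: graded_module_hom_def image_subset_iff)
  have \<epsilon>_hom: "\<epsilon> (v + w) = \<epsilon> v \<oplus>\<^bsub>?Q\<^esub> \<epsilon> w"
    "p \<in> polys X \<Longrightarrow> \<epsilon> (vscale p v) = p \<odot>\<^bsub>?Q\<^esub> \<epsilon> v"
    if "v \<in> free_vecs X (\<beta> 0)" "w \<in> free_vecs X (\<beta> 0)" for v w p
    using \<epsilon> that by (auto simp: graded_module_hom_def)
  have "\<exists>q\<in>homogeneous_part ?S (fst e). \<epsilon> (basis_vec e) = J +>\<^bsub>?S\<^esub> q" if "e \<in> basis_index (\<beta> 0)" for e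
  proof -
    have "\<epsilon> (basis_vec e) \<in> component ?Q (fst e)"
      using \<epsilon> that vhom_basis_vec[of e] by (fastforce simp: graded_module_hom_def)
    then show ?thesis by (auto simp: quotient_component[OF J])
  qed
  then have "\<forall>e. \<exists>q. e \<in> basis_index (\<beta> 0) \<longrightarrow> q \<in> homogeneous_part ?S (fst e) \<and> \<epsilon> (basis_vec e) = J +>\<^bsub>?S\<^esub> q"
    by blast
  then obtain q where q: "\<And>e. e \<in> basis_index (\<beta> 0) \<Longrightarrow> q e \<in> homogeneous_part ?S (fst e) \<and> \<epsilon> (basis_vec e) = J +>\<^bsub>?S\<^esub> q e"
    unfolding choice_iff by blast
  define d0 where "d0 = semilinear_ext UNIV (\<lambda>e. if e \<in> basis_index (\<beta> 0) then single (0, 0) (q e) else 0)"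
  define d1 where "d1 i = semilinear_ext UNIV (\<lambda>e. if e \<in> basis_index (\<beta> (Suc i)) then \<phi> i (basis_vec e) else 0)" for i
  have d0: "semilinear UNIV d0" by (simp add: d0_def)
  have qX: "q e \<in> polys X" if "e \<in> basis_index (\<beta> 0)" for e
    using q[OF that] by (simp add: homogeneous_part_def)
  have d0_free_vecs: "d0 v \<in> free_vecs X rank_one" if "v \<in> free_vecs X (\<beta> 0)" for v
    by (rule semilinear_free_vecs[OF d0 _ that]) (use qX in \<open>simp add: d0_def basis_index_rank_one\<close>)
  have d1: "\<phi> i v = d1 i v" if "v \<in> free_vecs X (\<beta> (Suc i))" for i v
    unfolding d1_def using that by (intro hom_eq_semilinear_ext) (auto simp: \<phi>_hom)
  have \<epsilon>_eq: "\<epsilon> v = J +>\<^bsub>?S\<^esub> lookup (d0 v) (0, 0)" if v: "v \<in> free_vecs X (\<beta> 0)" for v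
  proof -
    have "v \<in> free_vecs X (\<beta> 0) \<and> \<epsilon> v = J +>\<^bsub>?S\<^esub> lookup (d0 v) (0, 0)" using v
    proof (induction rule: free_vecs_induct)
      case zero
      \<comment> \<open>Additivity is known on cosets of polynomials, so \<open>\<epsilon> 0\<close>
        is first given a representative; scaling by \<open>0\<close> then identifies it.\<close>
      obtain p where p: "p \<in> polys X" "\<epsilon> 0 = J +>\<^bsub>?S\<^esub> p" using \<epsilon>_surj by (metis free_vecs_0 imageE imageI)
      have "\<epsilon> 0 = J +>\<^bsub>?S\<^esub> 0" using \<epsilon>_hom(2)[of 0 0 0] quotient_smult[OF J, of 0 p] p by simp
      then show ?case by (simp add: slinD[OF d0])
    next
      case (add v w)
      then have "lookup (d0 v) (0, 0) \<in> polys X" "lookup (d0 w) (0, 0) \<in> polys X"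
        using d0_free_vecs by (auto simp: free_vecs_def)
      then show ?case using add \<epsilon>_hom(1)[of v w] by (simp add: quotient_add[OF J] slinD[OF d0] lookup_add)
    next
      case (basis_vec e p)
      have "\<epsilon> (vscale p (basis_vec e)) = J +>\<^bsub>?S\<^esub> (p * q e)"
        using \<epsilon>_hom(2)[of "basis_vec e" "basis_vec e" p] basis_vec q qX quotient_smult[OF J] by simp
      moreover have "d0 (vscale p (basis_vec e)) = single (0, 0) (p * q e)"
        using basis_vec by (simp only: linD[OF d0]) (simp add: d0_def)
      ultimately show ?case using basis_vec by simp
    qed
    then show ?thesis ..
  qed
  have rank_one_embed_iff': "w \<in> rank_one_embed J \<longleftrightarrow> lookup w (0, 0) \<in> J" if "w \<in> free_vecs X rank_one" for w
    using that by (auto simp: free_vecs_rank_one rank_one_embed_iff)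
  show ?thesis
  proof (intro exI, unfold_locales)
    let ?b = "case_nat rank_one \<beta>" and ?d = "case_nat d0 d1"
    show "submod X (rank_one_embed J)" "graded (rank_one_embed J)"
      by (rule submod_embed[OF J], rule graded_embed[OF J hom])
    show lin: "semilinear UNIV (?d i)" for i by (cases i) (auto simp: d0_def d1_def)
    show basis_vec: "?d i (basis_vec e) \<in> free_vecs X (?b i)" if "e \<in> basis_index (?b (Suc i))" for i e
    proof (cases i)
      case (Suc k)
      then have "basis_vec e \<in> free_vecs X (\<beta> (Suc k))" using that by simp
      then show ?thesis using \<phi>_hom(1)[of "basis_vec e" k] d1[of "basis_vec e" k] Suc by simp
    qed (use that d0_free_vecs[of "basis_vec e"] in simp)
    show "vhom (fst e) (?d i (basis_vec e))" for i e
      using q[of e] single_homogeneous \<phi>_hom(4)[of "basis_vec e" _ "basis_vec e" "fst e"]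
      by (cases i) (auto simp: d0_def d1_def)
    show "\<exists>w\<in>free_vecs X (?b (Suc 0)). ?d 0 w - v \<in> rank_one_embed J" if v: "v \<in> free_vecs X (?b 0)" for v
    proof -
      obtain p where p: "p \<in> polys X" "v = single (0, 0) p" using v by (auto simp: free_vecs_rank_one)
      then obtain w where w: "w \<in> free_vecs X (\<beta> 0)" "\<epsilon> w = J +>\<^bsub>?S\<^esub> p" using \<epsilon>_surj by (metis imageE imageI)
      then have "lookup (d0 w) (0, 0) - p \<in> J" using \<epsilon>_eq coset_eq_iff[OF J] by simp
      then have "d0 w - v \<in> rank_one_embed J"
        using d0_free_vecs[OF w(1)] v by (subst rank_one_embed_iff') (auto simp: lookup_minus p)
      then show ?thesis using w by auto
    qed
    show "?d i v \<in> base_mod (rank_one_embed J) i \<longleftrightarrow> v \<in> ?d (Suc i) ` free_vecs X (?b (Suc (Suc i)))"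
      if "v \<in> free_vecs X (?b (Suc i))" for i v
    proof (cases i)
      case 0
      then have v: "v \<in> free_vecs X (\<beta> 0)" using that by simp
      have "d0 v \<in> rank_one_embed J \<longleftrightarrow> \<epsilon> v = J"
        using v by (simp add: rank_one_embed_iff' d0_free_vecs \<epsilon>_eq coset_eq_ideal_iff[OF J])
      also have "\<dots> \<longleftrightarrow> v \<in> \<phi> 0 ` free_vecs X (\<beta> 1)" using ker0 v by blast
      also have "\<phi> 0 ` free_vecs X (\<beta> 1) = d1 0 ` free_vecs X (\<beta> 1)" by (intro image_cong) (auto simp: d1)
      finally show ?thesis using 0 by simp
    next
      case (Suc k)
      then have v: "v \<in> free_vecs X (\<beta> (Suc k))" using that by simp
      have "d1 k v = 0 \<longleftrightarrow> v \<in> \<phi> (Suc k) ` free_vecs X (\<beta> (Suc (Suc k)))"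
        unfolding ker[of k, symmetric] using v d1[OF v] by simp
      also have "\<phi> (Suc k) ` free_vecs X (\<beta> (Suc (Suc k))) = d1 (Suc k) ` free_vecs X (\<beta> (Suc (Suc k)))"
        by (intro image_cong) (auto simp: d1)
      finally show ?thesis using Suc by simp
    qed
    show "const_coeff (lookup (?d (Suc i) v) e) = 0" if "v \<in> free_vecs X (?b (Suc (Suc i)))" for i v e
      using min[of v i e] that d1[of v i] by (simp add: irrelevant_ideal_def const_coeff_def)
  qed
qed

text \<open>Since \<open>J\<close> lies in the irrelevant ideal, \<open>S\<close> itself is the
  first module of a minimal resolution of \<open>S/J\<close>, continued by a resolution of
  \<open>J\<close>. The result is delivered in the form of \<open>minimal_res\<close>, where
  \<open>d 0\<close> is the identity, and in the form that \<open>graded_betti\<close> refers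
  to.\<close>

lemma resolution_exists_over:
  fixes J :: "('x, 'k::field) mpoly set"
  assumes "finite X" "A \<subseteq> X"
    and J: "ideal J (polynomial_ring X)" "J \<subseteq> irrelevant_ideal (polynomial_ring X)"
    and hom: "J \<subseteq> finite_sums (J \<inter> (\<Union>d. homogeneous_part (polynomial_ring X) d))"
    and gen: "J \<subseteq> finite_sums {p * g | p g. p \<in> polys X \<and> g \<in> J \<inter> polys A}"
  shows "\<exists>\<beta> d. minimal_res X (case_nat rank_one \<beta>) (rank_one_embed J) d \<and>
    (\<forall>i e e'. lookup (d i (basis_vec e)) e' \<in> polys A) \<and>
    (\<exists>\<epsilon> \<phi>. minimal_graded_free_resolution (polynomial_ring X) (quotient_module (polynomial_ring X) J) \<beta> \<epsilon> \<phi>)"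
proof -
  let ?S = "polynomial_ring X :: ('x, 'k) mpoly ring"
  let ?Q = "quotient_module ?S J"
  from resolution_exists[OF assms(1,2) submod_embed[OF J(1)] embed_subset_free_vecs[OF J(1)]
      graded_embed[OF J(1) hom] gen_over_embed[OF gen]]
  obtain b f where b0: "b 0 = rank_one" and f0: "f 0 ` free_vecs X (b 1) = rank_one_embed J"
    and f_ex: "\<forall>i. f (Suc i) ` free_vecs X (b (Suc (Suc i))) = {v \<in> free_vecs X (b (Suc i)). f i v = 0}"
    and f_lin: "\<forall>i. semilinear UNIV (f i) \<and> (\<forall>e. f i (basis_vec e) \<in> free_vecs A (b i) \<and> vhom (fst e) (f i (basis_vec e)))"
    and f_min: "\<forall>i. \<forall>v\<in>free_vecs X (b (Suc i)). f i v = 0 \<longrightarrow> (\<forall>e. const_coeff (lookup v e) = 0)"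
    by (elim exE conjE) (rule that)
  have fex: "\<And>i. f (Suc i) ` free_vecs X (b (Suc (Suc i))) = {v \<in> free_vecs X (b (Suc i)). f i v = 0}"
    and lin: "\<And>i. semilinear UNIV (f i)"
    and basis_vec: "\<And>i e. f i (basis_vec e) \<in> free_vecs A (b i)" "\<And>i e. vhom (fst e) (f i (basis_vec e))"
    and min: "\<And>i v e. v \<in> free_vecs X (b (Suc i)) \<Longrightarrow> f i v = 0 \<Longrightarrow> const_coeff (lookup v e) = 0"
    using f_ex f_lin f_min by simp_all
  have basX: "f i (basis_vec e) \<in> free_vecs X (b i)" for i e
    using basis_vec(1) free_vecs_mono[OF assms(2)] by blast
  have fFr: "f i v \<in> free_vecs X (b i)" if "v \<in> free_vecs X (b (Suc i))" for i v
    by (rule semilinear_free_vecs[OF lin basX that])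
  \<comment> \<open>At \<open>i = 0\<close> the image lies in the irrelevant ideal with
    \<open>J\<close>; later it is a kernel, whose entries lack constant terms by
    construction.\<close>
  have minimal: "const_coeff (lookup (f i v) e) = 0" if v: "v \<in> free_vecs X (b (Suc i))" for i v e
  proof (cases i)
    case 0
    then have "f i v \<in> rank_one_embed J" using f0 v by auto
    then obtain p where "p \<in> J" "f i v = single (0, 0) p" by (auto simp: rank_one_embed_def)
    moreover from this have "const_coeff p = 0" using J(2) by (auto simp: irrelevant_ideal_def const_coeff_def)
    ultimately show ?thesis by (simp add: lookup_single when_def)
  next
    case (Suc k)
    then have "f i v \<in> {v \<in> free_vecs X (b (Suc k)). f k v = 0}" using fex[of k] v by blast
    then show ?thesis using min by blast
  qed
  define d where "d = case_nat (\<lambda>v. v) f"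
  have "minimal_res X (case_nat rank_one b) (rank_one_embed J) d"
  proof unfold_locales
    let ?b = "case_nat rank_one b"
    show "submod X (rank_one_embed J)" "graded (rank_one_embed J)"
      by (rule submod_embed[OF J(1)], rule graded_embed[OF J(1) hom])
    show "semilinear UNIV (d i)" for i using lin by (cases i) (auto simp: d_def)
    show "d i (basis_vec e) \<in> free_vecs X (?b i)" if "e \<in> basis_index (?b (Suc i))" for i e
      using that basX by (cases i) (auto simp: d_def b0)
    show "vhom (fst e) (d i (basis_vec e))" for i e using basis_vec(2) by (cases i) (auto simp: d_def)
    show "\<exists>w\<in>free_vecs X (?b (Suc 0)). d 0 w - v \<in> rank_one_embed J" if "v \<in> free_vecs X (?b 0)" for v
      using that submodD(1)[OF submod_embed[OF J(1)]]
      by (intro bexI[of _ v]) (auto simp: d_def b0)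
    show "d i v \<in> base_mod (rank_one_embed J) i \<longleftrightarrow> v \<in> d (Suc i) ` free_vecs X (?b (Suc (Suc i)))"
      if "v \<in> free_vecs X (?b (Suc i))" for i v
      using that f0 fex by (cases i) (auto simp: d_def)
    show "const_coeff (lookup (d (Suc i) v) e) = 0" if "v \<in> free_vecs X (?b (Suc (Suc i)))" for i v e
      using that minimal by (simp add: d_def)
  qed
  moreover have "lookup (d i (basis_vec e)) e' \<in> polys A" for i e e'
  proof (cases i)
    case 0
    then show ?thesis by (simp add: d_def basis_vec_def lookup_single when_def)
  next
    case (Suc k)
    then show ?thesis using basis_vec(1)[of k e] by (simp add: d_def free_vecs_def)
  qed
  moreover have "minimal_graded_free_resolution ?S ?Q b (\<lambda>v. J +>\<^bsub>?S\<^esub> lookup v (0, 0)) f"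
    unfolding minimal_graded_free_resolution_def Let_def
  proof (intro conjI allI ballI)
    have lookup_polys: "lookup v e \<in> polys X" if "v \<in> free_vecs X c" for v :: "('x, 'k) fvec" and e c
      using that by (auto simp: free_vecs_def)
    have homog: "lookup v (0, 0) \<in> homogeneous_part ?S k" if "v \<in> free_vecs X c" "vhom k v" for v c k
      using that unfolding homogeneous_part_def vhom_def
      by (auto simp: lookup_polys in_keys_iff) (metis add_0 fst_conv)
    show "(\<lambda>v. J +>\<^bsub>?S\<^esub> lookup v (0, 0)) \<in> graded_module_hom ?S (graded_free_module ?S (b 0)) ?Q"
      unfolding graded_module_hom_def
      by (auto simp: lookup_polys lookup_add quotient_carrier[OF J(1)] quotient_add[OF J(1)]
          quotient_smult[OF J(1)] quotient_component[OF J(1)] homog)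
    show "f i \<in> graded_module_hom ?S (graded_free_module ?S (b (Suc i))) (graded_free_module ?S (b i))" for i
      unfolding graded_module_hom_def
      by (auto simp: fFr slinD[OF lin] semilinear_vhom[OF lin basis_vec(2)])
    show "(\<lambda>v. J +>\<^bsub>?S\<^esub> lookup v (0, 0)) ` carrier (graded_free_module ?S (b 0)) = carrier ?Q"
    proof (auto simp: quotient_carrier[OF J(1)] lookup_polys)
      fix p :: "('x, 'k) mpoly" assume "p \<in> polys X"
      then show "J +>\<^bsub>?S\<^esub> p \<in> (\<lambda>v. J +>\<^bsub>?S\<^esub> lookup v (0, 0)) ` free_vecs X (b 0)"
        by (intro image_eqI[of _ _ "single (0, 0) p"]) (auto simp: b0 free_vecs_rank_one)
    qed
    have "{v \<in> free_vecs X (b 0). lookup v (0, 0) \<in> J} = rank_one_embed J"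
      using embed_subset_free_vecs[OF J(1)] by (auto simp: b0 free_vecs_rank_one rank_one_embed_iff rank_one_embed_def)
    then show "a_kernel (graded_free_module ?S (b 0)) ?Q (\<lambda>v. J +>\<^bsub>?S\<^esub> lookup v (0, 0))
        = f 0 ` carrier (graded_free_module ?S (b 1))"
      using f0 by (simp add: a_kernel_def' quotient_zero[OF J(1)] coset_eq_ideal_iff[OF J(1)])
    show "a_kernel (graded_free_module ?S (b (Suc i))) (graded_free_module ?S (b i)) (f i)
        = f (Suc i) ` carrier (graded_free_module ?S (b (Suc (Suc i))))" for i
      using fex[of i] by (simp add: a_kernel_def')
    show "lookup (f i v) e \<in> irrelevant_ideal ?S" if "v \<in> carrier (graded_free_module ?S (b (Suc i)))" for i v e
      using that minimal[of v i e] lookup_polys[OF fFr[of v i]] by (simp add: irrelevant_ideal_def const_coeff_def)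
  qed
  ultimately show ?thesis by blast
qed

text \<open>Besides the chosen ranks \<open>\<beta>'\<close> and \<open>\<beta>\<close> there are
  the ranks \<open>\<beta>0\<close> of a resolution for \<open>J'\<close> with entries over
  \<open>A\<close>, and \<open>\<beta>' \<le> \<beta>0 \<le> \<beta>\<close>.\<close>

theorem graded_betti_retract_le:
  fixes J J' :: "('x, 'k::field) mpoly set"
  assumes "finite X" "A \<subseteq> X"
    and J: "ideal J (polynomial_ring X)" "J \<subseteq> irrelevant_ideal (polynomial_ring X)"
      "J \<subseteq> finite_sums (J \<inter> (\<Union>d. homogeneous_part (polynomial_ring X) d))"
    and J': "ideal J' (polynomial_ring X)"
      "J' \<subseteq> finite_sums (J' \<inter> (\<Union>d. homogeneous_part (polynomial_ring X) d))"
      "J' \<subseteq> finite_sums {p * g | p g. p \<in> polys X \<and> g \<in> J' \<inter> polys A}"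
    and sub: "J' \<subseteq> J" and retr: "slice A 0 ` J \<subseteq> J'"
  shows "graded_betti (polynomial_ring X) (quotient_module (polynomial_ring X) J') i j
    \<le> graded_betti (polynomial_ring X) (quotient_module (polynomial_ring X) J) i j"
proof -
  let ?S = "polynomial_ring X :: ('x, 'k) mpoly ring"
  define \<beta> where "\<beta> = graded_betti ?S (quotient_module ?S J)"
  define \<beta>' where "\<beta>' = graded_betti ?S (quotient_module ?S J')"
  have J'irr: "J' \<subseteq> irrelevant_ideal ?S" using sub J(2) by blast
  have "J \<subseteq> finite_sums {p * g | p g. p \<in> polys X \<and> g \<in> J \<inter> polys X}"
  proof
    fix p assume p: "p \<in> J"
    then have "1 * p \<in> {p * g | p g. p \<in> polys X \<and> g \<in> J \<inter> polys X}"
      using ideal_polys[OF J(1)] by (intro CollectI exI[of _ 1] exI[of _ p]) auto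
    then show "p \<in> finite_sums {p * g | p g. p \<in> polys X \<and> g \<in> J \<inter> polys X}"
      by (intro finite_sums_incl) simp
  qed
  from resolution_exists_over[OF assms(1) subset_refl J this]
  have "\<exists>\<beta> \<epsilon> \<phi>. minimal_graded_free_resolution ?S (quotient_module ?S J) \<beta> \<epsilon> \<phi>" by blast
  then have "\<exists>\<epsilon> \<phi>. minimal_graded_free_resolution ?S (quotient_module ?S J) \<beta> \<epsilon> \<phi>"
    unfolding \<beta>_def graded_betti_def by (rule someI_ex)
  then obtain d where F: "minimal_res X (case_nat rank_one \<beta>) (rank_one_embed J) d"
    using minimal_res_of_resolution[OF J(1,3)] by blast
  obtain \<beta>0 d0 where G: "minimal_res X (case_nat rank_one \<beta>0) (rank_one_embed J') d0"
      "\<And>i e e'. lookup (d0 i (basis_vec e)) e' \<in> polys A"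
    and ex: "\<exists>\<epsilon> \<phi>. minimal_graded_free_resolution ?S (quotient_module ?S J') \<beta>0 \<epsilon> \<phi>"
    using resolution_exists_over[OF assms(1,2) J'(1) J'irr J'(2,3)] by blast
  from ex have "\<exists>\<beta> \<epsilon> \<phi>. minimal_graded_free_resolution ?S (quotient_module ?S J') \<beta> \<epsilon> \<phi>" by blast
  then have "\<exists>\<epsilon> \<phi>. minimal_graded_free_resolution ?S (quotient_module ?S J') \<beta>' \<epsilon> \<phi>"
    unfolding \<beta>'_def graded_betti_def by (rule someI_ex)
  then obtain d' where G': "minimal_res X (case_nat rank_one \<beta>') (rank_one_embed J') d'"
    using minimal_res_of_resolution[OF J'(1,2)] by blast
  \<comment> \<open>For \<open>UNIV\<close> the substitution is the identity and every matrix is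
    admissible, so two resolutions of the same module are compared.\<close>
  have "vslice UNIV 0 ` rank_one_embed J' \<subseteq> rank_one_embed J'"
    by (auto simp: vslice_0_id polys_def)
  then have le: "\<beta>' i j \<le> \<beta>0 i j"
    using betti_retract_le[OF G' G(1), of UNIV i j] by (simp add: polys_def)
  have "vslice A 0 (single (0, 0) p) = single (0, 0) (slice A 0 p)" for p :: "('x, 'k) mpoly"
    by (rule poly_mapping_eqI) (simp add: lookup_single when_def)
  then have "vslice A 0 ` rank_one_embed J \<subseteq> rank_one_embed J'" using retr by (auto simp: rank_one_embed_def)
  moreover have "rank_one_embed J' \<subseteq> rank_one_embed J" using sub by (auto simp: rank_one_embed_def)
  ultimately have "\<beta>0 i j \<le> \<beta> i j"
    using betti_retract_le[OF G(1) F, of A i j] G(2) by simp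
  with le show ?thesis by (simp add: \<beta>_def \<beta>'_def)
qed

section \<open>Powers of ideals\<close>

lemma finite_sums_mono: "A \<subseteq> finite_sums B \<Longrightarrow> finite_sums A \<subseteq> finite_sums B"
  by (rule finite_sums_subset) (auto intro: finite_sums.zero finite_sums_plus)

lemma ideals_set_simps [simp]:
  "one (ideals_set R) = carrier R" "mult (ideals_set R) = ideal_prod R"
  by (simp_all add: ideals_set_def)

lemma ideal_prod_intros:
  "i \<in> I \<Longrightarrow> j \<in> J \<Longrightarrow> i * j \<in> ideal_prod (polynomial_ring X) I J"
  "p \<in> ideal_prod (polynomial_ring X) I J \<Longrightarrow> q \<in> ideal_prod (polynomial_ring X) I J \<Longrightarrow>
    p + q \<in> ideal_prod (polynomial_ring X) I J"
  using ideal_prod.intros[where R = "polynomial_ring X"] by auto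

text \<open>The finite sums of multiples form an ideal containing \<open>G\<close>; minimality of
  \<open>genideal\<close> gives the last inclusion.\<close>

lemma genideal_polynomial_ring:
  assumes "G \<subseteq> polys X"
  shows "ideal (genideal (polynomial_ring X) G) (polynomial_ring X)"
    "G \<subseteq> genideal (polynomial_ring X) G"
    "genideal (polynomial_ring X) G \<subseteq> finite_sums {p * g | p g. p \<in> polys X \<and> g \<in> G}"
proof -
  interpret cring "polynomial_ring X" by (rule cring_polynomial_ring)
  show "ideal (genideal (polynomial_ring X) G) (polynomial_ring X)" "G \<subseteq> genideal (polynomial_ring X) G"
    using assms by (auto intro!: genideal_ideal genideal_self[THEN subsetD])
  define D where "D = {p * g | p g. p \<in> polys X \<and> g \<in> G}"
  have DX: "finite_sums D \<subseteq> polys X" using assms by (intro finite_sums_subset) (auto simp: D_def)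
  have mult: "p * q \<in> finite_sums D" if "q \<in> finite_sums D" "p \<in> polys X" for p q
    using that
  proof induction
    case (add a b)
    then obtain r g where a: "a = r * g" "r \<in> polys X" "g \<in> G" by (auto simp: D_def)
    then have "p * a \<in> D" using add.prems
      unfolding D_def mem_Collect_eq by (intro exI[of _ "p * r"] exI[of _ g]) (simp add: mult.assoc)
    then show ?case using add by (simp add: distrib_left finite_sums.add)
  qed (simp add: finite_sums.zero)
  have "ideal (finite_sums D) (polynomial_ring X)"
  proof (rule idealI)
    have "inv\<^bsub>add_monoid (polynomial_ring X)\<^esub> q \<in> finite_sums D" if q: "q \<in> finite_sums D" for q
    proof -
      have "inv\<^bsub>add_monoid (polynomial_ring X)\<^esub> q = - 1 * q"
        using polynomial_ring_a_inv[of q X] DX q by (auto simp: a_inv_def)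
      then show ?thesis using mult[OF q, of "- 1"] by simp
    qed
    then show "subgroup (finite_sums D) (add_monoid (polynomial_ring X))"
      using DX finite_sums.zero finite_sums_plus by (auto simp: subgroup_def)
  qed (use mult ring_axioms in \<open>auto simp: mult.commute\<close>)
  moreover have "g \<in> D" if "g \<in> G" for g
    unfolding D_def mem_Collect_eq using that by (intro exI[of _ 1] exI[of _ g]) simp
  then have "G \<subseteq> finite_sums D" using finite_sums_incl by blast
  ultimately show "genideal (polynomial_ring X) G \<subseteq> finite_sums {p * g | p g. p \<in> polys X \<and> g \<in> G}"
    unfolding D_def[symmetric] by (rule genideal_minimal)
qed

abbreviation ideal_pow :: "'x set \<Rightarrow> ('x, 'k::comm_ring_1) mpoly set \<Rightarrow> nat \<Rightarrow> ('x, 'k) mpoly set" where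
  "ideal_pow X I t \<equiv> I [^]\<^bsub>ideals_set (polynomial_ring X)\<^esub> t"

lemma ideal_pow_simps:
  "ideal_pow X I 0 = polys X"
  "ideal_pow X I (Suc t) = ideal_prod (polynomial_ring X) (ideal_pow X I t) I"
  by simp_all

lemma ideal_ideal_pow:
  assumes "ideal I (polynomial_ring X)" shows "ideal (ideal_pow X I t) (polynomial_ring X)"
proof -
  interpret cring "polynomial_ring X" by (rule cring_polynomial_ring)
  show ?thesis
  proof (induction t)
    case 0
    then show ?case using oneideal by (simp add: ideal_pow_simps)
  next
    case (Suc t)
    then show ?case using ideal_prod_is_ideal[OF _ assms] by (simp add: ideal_pow_simps)
  qed
qed

lemma ideal_pow_Suc_subset:
  assumes "ideal I (polynomial_ring X)" shows "ideal_pow X I (Suc t) \<subseteq> I"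
proof -
  interpret cring "polynomial_ring X" by (rule cring_polynomial_ring)
  show ?thesis
    using ideal_prod_inter[OF ideal_ideal_pow[OF assms, of t] assms] by (simp add: ideal_pow_simps)
qed

lemma ideal_pow_mono: "I' \<subseteq> I \<Longrightarrow> ideal_pow X I' t \<subseteq> ideal_pow X I t"
proof (induction t)
  case (Suc t)
  have "x \<in> ideal_pow X I (Suc t)" if "x \<in> ideal_prod (polynomial_ring X) (ideal_pow X I' t) I'" for x
    using that unfolding ideal_pow_simps
    by induction (use Suc in \<open>auto intro: ideal_prod_intros\<close>)
  then show ?case unfolding ideal_pow_simps by blast
qed (simp add: ideal_pow_simps)

text \<open>The substitution is a ring endomorphism that preserves \<open>polys X\<close>, so sums
  of products go to sums of products.\<close>

lemma ideal_pow_retract: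
  assumes "slice A 0 ` I \<subseteq> I'"
  shows "slice A 0 ` ideal_pow X I t \<subseteq> ideal_pow X I' t"
proof (induction t)
  case 0
  then show ?case by (auto simp: ideal_pow_simps slice_0_polys)
next
  case (Suc t)
  have "slice A 0 x \<in> ideal_pow X I' (Suc t)" if "x \<in> ideal_prod (polynomial_ring X) (ideal_pow X I t) I" for x
    using that unfolding ideal_pow_simps
  proof induction
    case (prod i j)
    then show ?case using Suc assms by (auto intro: ideal_prod_intros)
  qed (auto intro: ideal_prod_intros)
  then show ?case unfolding ideal_pow_simps by blast
qed

section \<open>Homogeneous generators and generators over fewer variables for powers\<close>

lemma homogeneous_mult:
  assumes "p \<in> homogeneous_part (polynomial_ring X) d" "q \<in> homogeneous_part (polynomial_ring X) e"
  shows "p * q \<in> homogeneous_part (polynomial_ring X) (d + e)"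
  using assms keys_mult[of p q] by (fastforce simp: homogeneous_part_def monomial_degree_add)

lemma homogeneous_single:
  "keys u \<subseteq> X \<Longrightarrow> single u c \<in> homogeneous_part (polynomial_ring X) (monomial_degree u)"
  by (auto simp: homogeneous_part_def polys_single)

lemma polys_finite_sums_monomials:
  assumes "p \<in> polys X" shows "p \<in> finite_sums {single u c | u c. keys u \<subseteq> X}"
  using assms by (induction rule: polys_induct) (auto intro: finite_sums.zero finite_sums_plus finite_sums_incl)

lemma ideal_pow_homogeneous:
  assumes "I \<subseteq> finite_sums (I \<inter> (\<Union>d. homogeneous_part (polynomial_ring X) d))"
  shows "ideal_pow X I t \<subseteq> finite_sums (ideal_pow X I t \<inter> (\<Union>d. homogeneous_part (polynomial_ring X) d))"
proof (induction t)
  case 0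
  have "finite_sums {single u c | u c. keys u \<subseteq> X} \<subseteq> finite_sums (polys X \<inter> (\<Union>d. homogeneous_part (polynomial_ring X) d))"
    by (rule finite_sums_mono) (auto intro!: finite_sums_incl polys_single homogeneous_single)
  then show ?case unfolding ideal_pow_simps using polys_finite_sums_monomials by blast
next
  case (Suc t)
  let ?D = "ideal_pow X I (Suc t) \<inter> (\<Union>d. homogeneous_part (polynomial_ring X) d)"
  have "x \<in> finite_sums ?D" if "x \<in> ideal_prod (polynomial_ring X) (ideal_pow X I t) I" for x
    using that
  proof induction
    case (prod i j)
    have "i * j \<in> finite_sums ?D"
    proof (rule finite_sums_mult)
      show "i \<in> finite_sums (ideal_pow X I t \<inter> (\<Union>d. homogeneous_part (polynomial_ring X) d))"
        using Suc prod(1) by blast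
      show "j \<in> finite_sums (I \<inter> (\<Union>d. homogeneous_part (polynomial_ring X) d))"
        using assms prod(2) by blast
      fix a b
      assume a: "a \<in> ideal_pow X I t \<inter> (\<Union>d. homogeneous_part (polynomial_ring X) d)"
        and b: "b \<in> I \<inter> (\<Union>d. homogeneous_part (polynomial_ring X) d)"
      have "a * b \<in> ideal_pow X I (Suc t)"
        unfolding ideal_pow_simps using a b by (intro ideal_prod_intros) auto
      then show "a * b \<in> finite_sums ?D" using a b by (intro finite_sums_incl) (auto intro: homogeneous_mult)
    qed
    then show ?case by simp
  qed (simp add: finite_sums_plus)
  then show ?case unfolding ideal_pow_simps(2) by blast
qed

text \<open>In a product, the multipliers over \<open>X\<close> and the factors over
  \<open>A\<close> are collected separately. For exponent \<open>0\<close> the factor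
  \<open>1\<close> suffices.\<close>

lemma ideal_pow_generated:
  assumes "I \<subseteq> finite_sums {p * g | p g. p \<in> polys X \<and> g \<in> I \<inter> polys A}"
  shows "ideal_pow X I t \<subseteq> finite_sums {p * g | p g. p \<in> polys X \<and> g \<in> ideal_pow X I t \<inter> polys A}"
proof (induction t)
  case 0
  have "p \<in> finite_sums {p * g | p g. p \<in> polys X \<and> g \<in> polys X \<inter> polys A}" if "p \<in> polys X" for p
    using that by (intro finite_sums_incl CollectI exI[of _ p] exI[of _ 1]) simp
  then show ?case unfolding ideal_pow_simps by blast
next
  case (Suc t)
  let ?D = "{p * g | p g. p \<in> polys X \<and> g \<in> ideal_pow X I (Suc t) \<inter> polys A}"
  have "x \<in> finite_sums ?D" if "x \<in> ideal_prod (polynomial_ring X) (ideal_pow X I t) I" for x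
    using that
  proof induction
    case (prod i j)
    have "i * j \<in> finite_sums ?D"
    proof (rule finite_sums_mult)
      show "i \<in> finite_sums {p * g | p g. p \<in> polys X \<and> g \<in> ideal_pow X I t \<inter> polys A}"
        using Suc prod(1) by blast
      show "j \<in> finite_sums {p * g | p g. p \<in> polys X \<and> g \<in> I \<inter> polys A}"
        using assms prod(2) by blast
      fix a b
      assume "a \<in> {p * g | p g. p \<in> polys X \<and> g \<in> ideal_pow X I t \<inter> polys A}"
        "b \<in> {p * g | p g. p \<in> polys X \<and> g \<in> I \<inter> polys A}"
      then obtain p g q h where ab: "a = p * g" "b = q * h" "p \<in> polys X" "q \<in> polys X"
        "g \<in> ideal_pow X I t \<inter> polys A" "h \<in> I \<inter> polys A" by blast
      have "g * h \<in> ideal_pow X I (Suc t)"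
        unfolding ideal_pow_simps using ab by (intro ideal_prod_intros) auto
      then show "a * b \<in> finite_sums ?D"
        using ab by (intro finite_sums_incl CollectI exI[of _ "p * q"] exI[of _ "g * h"]) (simp add: algebra_simps)
    qed
    then show ?case by simp
  qed (simp add: finite_sums_plus)
  then show ?case unfolding ideal_pow_simps(2) by blast
qed

section \<open>Corner-interval minors\<close>

lemma slice_var: "slice A 0 (var x) = (if x \<in> A then var x else 0)"
proof (cases "x \<in> A")
  case True
  then show ?thesis by (simp add: var_def slice_0_id polys_single)
next
  case False
  then have "lookup (restrict_monomial (- A) (single x 1)) x \<noteq> 0" by (simp add: lookup_restrict_monomial)
  then have "restrict_monomial (- A) (single x 1) \<noteq> 0" by (metis lookup_zero)
  then show ?thesis using False by (simp add: var_def slice_single)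
qed

lemma var_homogeneous: "x \<in> X \<Longrightarrow> var x \<in> homogeneous_part (polynomial_ring X) 1"
  using homogeneous_single[of "single x 1" X 1] by (simp add: var_def monomial_degree_def)

lemma homogeneous_diff:
  "p \<in> homogeneous_part (polynomial_ring X) d \<Longrightarrow> q \<in> homogeneous_part (polynomial_ring X) d \<Longrightarrow>
    p - q \<in> homogeneous_part (polynomial_ring X) d"
  using keys_diff[of p q] by (fastforce simp: homogeneous_part_def)

lemma minor_binomial_homogeneous:
  assumes "minor_vertices \<delta> \<subseteq> X"
  shows "minor_binomial \<delta> \<in> homogeneous_part (polynomial_ring X) 2"
proof (cases \<delta>)
  case (Minor a1 a2 b1 b2)
  then have "minor_binomial \<delta> \<in> homogeneous_part (polynomial_ring X) (1 + 1)"
    using assms by (simp only: minor_binomial.simps)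
      (intro homogeneous_diff homogeneous_mult var_homogeneous; simp)
  then show ?thesis by (simp add: numeral_2_eq_2)
qed

lemma homogeneous_polys: "p \<in> homogeneous_part (polynomial_ring X) d \<Longrightarrow> p \<in> polys X"
  by (simp add: homogeneous_part_def)

text \<open>Any two vertices of \<open>C\<close> in row \<open>a\<close> are joined through the hub
  \<open>(a, 1)\<close>, because every minor of \<open>C\<close> has its left column at
  \<open>1\<close>. For empty \<open>C\<close> both sides are empty and any row serves.\<close>

lemma maximal_horizontal_interval_removal:
  assumes C: "C \<subseteq> corner_interval_minors m n" and H: "maximal_horizontal_interval C H"
  shows "\<exists>a. remove_vertices C H = {\<delta> \<in> C. row1 \<delta> \<noteq> a \<and> row2 \<delta> \<noteq> a}"
proof (cases "C = {}")
  case False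
  have corner: "\<delta> = Minor (row1 \<delta>) (row2 \<delta>) 1 (col2 \<delta>)" if "\<delta> \<in> C" for \<delta>
    using C that by (cases \<delta>) (auto simp: corner_interval_minors_def)
  have int: "horizontal_interval C H" and max: "\<And>H'. horizontal_interval C H' \<Longrightarrow> \<not> H \<subset> H'"
    using H by (auto simp: maximal_horizontal_interval_def)
  obtain a where a: "H \<subseteq> {x. fst x = a}" using int unfolding horizontal_interval_def by blast
  have "H \<noteq> {}"
  proof
    assume "H = {}"
    obtain \<delta> where "\<delta> \<in> C" using False by blast
    then have "horizontal_interval C {(row1 \<delta>, 1)}"
      using corner[of \<delta>] by (cases \<delta>)
        (auto simp: horizontal_interval_def vertices_def horizontal_path_connected_def intro!: bexI[of _ \<delta>])
    then show False using max \<open>H = {}\<close> by blast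
  qed
  define R where "R = {x \<in> vertices C. fst x = a}"
  define E where "E = {(x, y). \<exists>\<delta>\<in>C. {x, y} \<in> horizontal_edges \<delta>}"
  have edge: "(x, (a, 1)) \<in> E\<^sup>* \<and> ((a, 1), x) \<in> E\<^sup>*" if x: "x \<in> R" for x
  proof -
    obtain \<delta> where \<delta>: "\<delta> \<in> C" "x \<in> minor_vertices \<delta>" using x by (auto simp: R_def vertices_def)
    obtain a1 a2 b where eq: "\<delta> = Minor a1 a2 1 b" using corner[OF \<delta>(1)] by blast
    have "x = (a, 1) \<or> {x, (a, 1)} \<in> horizontal_edges \<delta> \<and> {(a, 1), x} \<in> horizontal_edges \<delta>"
      using \<delta>(2) x by (auto simp: eq R_def doubleton_eq_iff)
    then have "x = (a, 1) \<or> (x, (a, 1)) \<in> E \<and> ((a, 1), x) \<in> E"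
      unfolding E_def using \<delta>(1) by blast
    then show ?thesis by auto
  qed
  have "horizontal_interval C R"
    unfolding horizontal_interval_def horizontal_path_connected_def E_def[symmetric]
  proof (intro conjI ballI)
    fix u v assume "u \<in> R" "v \<in> R"
    then show "(u, v) \<in> E\<^sup>*" using edge by (intro rtrancl_trans[of u "(a, 1)" E v]) auto
  qed (auto simp: R_def)
  moreover have "H \<subseteq> R" using a int by (auto simp: R_def horizontal_interval_def)
  ultimately have "H = R" using max by blast
  have "minor_vertices \<delta> \<inter> H = {} \<longleftrightarrow> row1 \<delta> \<noteq> a \<and> row2 \<delta> \<noteq> a" if "\<delta> \<in> C" for \<delta>
    using that by (cases \<delta>) (auto simp: \<open>H = R\<close> R_def vertices_def intro: bexI[of _ \<delta>])
  then show ?thesis by (auto simp: remove_vertices_def)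
qed (auto simp: remove_vertices_def)

lemma finite_vertices:
  assumes "C \<subseteq> corner_interval_minors m n" shows "finite (vertices C)"
proof -
  have "vertices C \<subseteq> {1..m} \<times> {1..n}"
    using assms by (fastforce simp: vertices_def corner_interval_minors_def two_minors_def)
  then show ?thesis by (rule finite_subset) simp
qed

text \<open>Everything is read off the generators, which are forms of degree \<open>2\<close> in the
  variables of \<open>A\<close>. The lemma serves \<open>C\<close> with \<open>A = X\<close> and
  \<open>C'\<close> with the variables outside the removed row.\<close>

lemma minor_ideal_props:
  fixes C :: "two_minor set" and X :: "(nat \<times> nat) set"
  defines "I \<equiv> minor_ideal (polynomial_ring X) C :: (nat \<times> nat, 'k::field) mpoly set"
  assumes "A \<subseteq> X" "\<forall>\<delta>\<in>C. minor_vertices \<delta> \<subseteq> A"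
  shows "ideal I (polynomial_ring X)" "minor_binomial ` C \<subseteq> I"
    "I \<subseteq> finite_sums {p * g | p g. p \<in> polys X \<and> g \<in> minor_binomial ` C}"
    "I \<subseteq> finite_sums {p * g | p g. p \<in> polys X \<and> g \<in> I \<inter> polys A}"
    "I \<subseteq> finite_sums (I \<inter> (\<Union>d. homogeneous_part (polynomial_ring X) d))"
    "I \<subseteq> irrelevant_ideal (polynomial_ring X)"
proof -
  define G where "G = (minor_binomial ` C :: (nat \<times> nat, 'k) mpoly set)"
  have GA: "G \<subseteq> polys A" unfolding G_def
    using minor_binomial_homogeneous homogeneous_polys assms(3) by blast
  then have GX: "G \<subseteq> polys X" using polys_mono[OF assms(2)] by blast
  have I: "I = genideal (polynomial_ring X) G" by (simp add: I_def minor_ideal_def G_def)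
  note gen = genideal_polynomial_ring[OF GX, folded I]
  show id: "ideal I (polynomial_ring X)" "minor_binomial ` C \<subseteq> I"
    "I \<subseteq> finite_sums {p * g | p g. p \<in> polys X \<and> g \<in> minor_binomial ` C}"
    using gen by (simp_all add: G_def)
  have "finite_sums {p * g | p g. p \<in> polys X \<and> g \<in> G} \<subseteq> finite_sums {p * g | p g. p \<in> polys X \<and> g \<in> I \<inter> polys A}"
  proof (rule finite_sums_mono)
    show "{p * g | p g. p \<in> polys X \<and> g \<in> G} \<subseteq> finite_sums {p * g | p g. p \<in> polys X \<and> g \<in> I \<inter> polys A}"
      using gen(2) GA by (intro subsetI finite_sums_incl) blast
  qed
  then show "I \<subseteq> finite_sums {p * g | p g. p \<in> polys X \<and> g \<in> I \<inter> polys A}" using gen(3) by blast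
  let ?D = "I \<inter> (\<Union>d. homogeneous_part (polynomial_ring X) d)"
  have "p * g \<in> finite_sums ?D" if "p \<in> polys X" "g \<in> G" for p g
  proof (rule finite_sums_mult[OF polys_finite_sums_monomials[OF that(1)] finite_sums_incl[of g G]])
    fix a b assume "a \<in> {single u c :: (nat \<times> nat, 'k) mpoly | u c. keys u \<subseteq> X}" "b \<in> G"
    then obtain u c where a: "a = single u c" "keys u \<subseteq> X" by blast
    have "b \<in> homogeneous_part (polynomial_ring X) 2"
      using \<open>b \<in> G\<close> minor_binomial_homogeneous assms(2,3) unfolding G_def by blast
    then have "a * b \<in> homogeneous_part (polynomial_ring X) (monomial_degree u + 2)"
      unfolding a(1) by (intro homogeneous_mult homogeneous_single a)
    moreover have "a * b \<in> I"
      using \<open>b \<in> G\<close> gen(2) a by (intro ideal_mult[OF id(1)]) (auto simp: polys_single)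
    ultimately show "a * b \<in> finite_sums ?D" by (intro finite_sums_incl) blast
  qed (use that in simp)
  then have "finite_sums {p * g | p g. p \<in> polys X \<and> g \<in> G} \<subseteq> finite_sums ?D"
    by (intro finite_sums_mono) auto
  then show "I \<subseteq> finite_sums ?D" using gen(3) by blast
  have "const_coeff g = 0" if "g \<in> G" for g
  proof -
    have "g \<in> homogeneous_part (polynomial_ring X) 2"
      using that minor_binomial_homogeneous assms(2,3) unfolding G_def by blast
    then have "\<forall>u\<in>keys g. monomial_degree u = 2" by (simp add: homogeneous_part_def)
    moreover have "monomial_degree (0 :: nat \<times> nat \<Rightarrow>\<^sub>0 nat) = 0" by (simp add: monomial_degree_def)
    ultimately have "0 \<notin> keys g" by force
    then show ?thesis by (simp add: const_coeff_def in_keys_iff)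
  qed
  then have "finite_sums {p * g | p g. p \<in> polys X \<and> g \<in> G} \<subseteq> {p. const_coeff p = 0}"
    by (intro finite_sums_subset) auto
  then show "I \<subseteq> irrelevant_ideal (polynomial_ring X)"
    using gen(3) ideal_polys[OF id(1)] by (auto simp: irrelevant_ideal_def const_coeff_def)
qed

theorem proposition5p8:
  fixes m n i j t :: nat
    and C C' :: "two_minor set"
    and H :: "(nat \<times> nat) set"
    and S :: "(nat \<times> nat, 'k::field) mpoly ring"
  assumes "C \<subseteq> corner_interval_minors m n"
    and "S = polynomial_ring (vertices C)"
    and "maximal_horizontal_interval C H"
    and "C' = remove_vertices C H"
    and "t \<ge> 1"
  shows "graded_betti S (quotient_module S (minor_ideal S C' [^]\<^bsub>ideals_set S\<^esub> t)) i j
       \<le> graded_betti S (quotient_module S (minor_ideal S C [^]\<^bsub>ideals_set S\<^esub> t)) i j"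
proof -
  define X where "X = vertices C"
  obtain a where a: "C' = {\<delta> \<in> C. row1 \<delta> \<noteq> a \<and> row2 \<delta> \<noteq> a}"
    using maximal_horizontal_interval_removal[OF assms(1,3)] assms(4) by blast
  define A where "A = {x \<in> X. fst x \<noteq> a}"
  define I where "I = (minor_ideal (polynomial_ring X) C :: (nat \<times> nat, 'k) mpoly set)"
  define I' where "I' = (minor_ideal (polynomial_ring X) C' :: (nat \<times> nat, 'k) mpoly set)"
  have AX: "A \<subseteq> X" by (auto simp: A_def)
  have CX: "\<forall>\<delta>\<in>C. minor_vertices \<delta> \<subseteq> X" by (auto simp: X_def vertices_def)
  have C'A: "\<forall>\<delta>\<in>C'. minor_vertices \<delta> \<subseteq> A"
  proof
    fix \<delta> assume "\<delta> \<in> C'"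
    then show "minor_vertices \<delta> \<subseteq> A" using CX by (cases \<delta>) (auto simp: a A_def)
  qed
  note I = minor_ideal_props[where 'k = 'k, OF subset_refl CX, folded I_def]
  note I' = minor_ideal_props[where 'k = 'k, OF AX C'A, folded I'_def]
  interpret cring "polynomial_ring X :: (nat \<times> nat, 'k) mpoly ring" by (rule cring_polynomial_ring)
  have sub: "I' \<subseteq> I"
    unfolding I'_def minor_ideal_def using I(2) a by (intro genideal_minimal I(1)) auto
  have "slice A 0 (minor_binomial \<delta>) \<in> I'" if "\<delta> \<in> C" for \<delta>
  proof (cases "\<delta> \<in> C'")
    case True
    then have "(minor_binomial \<delta> :: (nat \<times> nat, 'k) mpoly) \<in> polys A"
      using minor_binomial_homogeneous C'A homogeneous_polys by blast
    then show ?thesis using I'(2) True by (auto simp: slice_0_id)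
  next
    case False
    \<comment> \<open>Both terms of the binomial contain a variable from each row of the minor, in
      particular one from row \<open>a\<close>, so the substitution annihilates both.\<close>
    then have "row1 \<delta> = a \<or> row2 \<delta> = a" using that a by blast
    moreover have "slice A 0 (p - q) = slice A 0 p - slice A 0 q" for p q :: "(nat \<times> nat, 'k) mpoly"
      by (rule additive_diff) simp
    ultimately have "slice A 0 (minor_binomial \<delta>) = (0 :: (nat \<times> nat, 'k) mpoly)"
      by (cases \<delta>) (auto simp: slice_var A_def)
    then show ?thesis using ideal_0[OF I'(1)] by simp
  qed
  moreover have "slice A 0 p \<in> polys X" if "p \<in> polys X" for p :: "(nat \<times> nat, 'k) mpoly"
    using that by (rule slice_0_polys)
  \<comment> \<open>The polynomials sent into \<open>I'\<close> include the multiples of the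
    generators and are closed under addition, so they include \<open>I\<close>.\<close>
  ultimately have "finite_sums {p * g | p g. p \<in> polys X \<and> g \<in> minor_binomial ` C} \<subseteq> {p. slice A 0 p \<in> I'}"
    by (intro finite_sums_subset) (auto simp: ideal_mult[OF I'(1)] ideal_0[OF I'(1)] ideal_add[OF I'(1)])
  then have retr: "slice A 0 ` I \<subseteq> I'" using I(3) by blast
  \<comment> \<open>\<open>t \<ge> 1\<close> puts the power inside \<open>I\<close> and hence in the
    irrelevant ideal, so that the resolution starts with \<open>S\<close>.\<close>
  obtain s where t: "t = Suc s" using assms(5) by (cases t) auto
  have "finite X" unfolding X_def by (rule finite_vertices[OF assms(1)])
  moreover have "ideal_pow X I t \<subseteq> irrelevant_ideal (polynomial_ring X)"
    using ideal_pow_Suc_subset[OF I(1), of s] I(6) unfolding t by blast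
  ultimately have "graded_betti (polynomial_ring X) (quotient_module (polynomial_ring X) (ideal_pow X I' t)) i j
    \<le> graded_betti (polynomial_ring X) (quotient_module (polynomial_ring X) (ideal_pow X I t)) i j"
    by (intro graded_betti_retract_le[of X A] AX ideal_ideal_pow ideal_pow_homogeneous
        ideal_pow_generated ideal_pow_mono ideal_pow_retract I I' sub retr)
  then show ?thesis unfolding assms(2) I_def I'_def X_def .
qed

end
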